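(* The closed convex hull $\overline{co}\,\mathcal{U}$ consists of all functions $f$ represented by $$f(z)=\int_{|x|=1}\frac{z}{(1-xz)^2}\,d\mu(x),\qquad z\in\mathbb{D},$$ where $\mu\in\wedge$. Further, the set $E\overline{co}\,\mathcal{U}$ of extreme points of $\overline{co}\,\mathcal{U}$ consists of the functions of the form $$f(z)=\frac{z}{(1-xz)^2},\qquad |x|=1.$$
   Context: $\mathbb{D}=\{z\in\mathbb{C}:|z|<1\}$ is the unit disk. $\mathcal{H}$ is the space of analytic functions on $\mathbb{D}$ with the topology of uniform convergence on compact subsets of $\mathbb{D}$. $\mathcal{A}$ is the class of $f\in\mathcal{H}$ with $f(0)=0$ and $f'(0)=1$. $\mathcal{U}$ is the class of functions $f\in\mathcal{A}$ satisfying $$\left|f'(z)\left(\frac{z}{f(z)}\right)^2-1\right|<1\quad\text{for all } z\in\mathbb{D};$$ here functions in $\mathcal{U}$ are non-vanishing in $\mathbb{D}\setminus\{0\}$, and $z/f(z)$ is understood to take the value $1$ at $z=0$. For $V\subseteq\mathcal{H}$, $\overline{co}\,V$ denotes the closed convex hull of $V$ in $\mathcal{H}$ (the smallest closed convex set containing $V$), and $EV$ denotes the set of extreme points of $V$. $\wedge$ denotes the set of (Borel) probability measures on the unit circle $\partial\mathbb{D}=\{x\in\mathbb{C}:|x|=1\}$. *)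

theory Defs
  imports "HOL-Complex_Analysis.Complex_Analysis" "HOL-Probability.Probability"
begin

abbreviation unit_disk :: "complex set" where
  "unit_disk \<equiv> ball 0 1"

text \<open>
  An analytic function on the disk is represented by the extensional function that is
  \<^const>\<open>undefined\<close> off the disk, so that equality of elements is equality on the disk.
\<close>

typedef hol_disk = "{f :: complex \<Rightarrow> complex. f holomorphic_on unit_disk \<and> f \<in> extensional unit_disk}"
  morphisms hol_fun Abs_hol_disk
proof -
  have "(\<lambda>z\<in>unit_disk. 0 :: complex) holomorphic_on unit_disk"
    by (rule holomorphic_transform[of "\<lambda>_. 0"]) auto
  then show ?thesis by (intro exI[of _ "\<lambda>z\<in>unit_disk. 0"]) auto
qed

setup_lifting type_definition_hol_disk

lemma holomorphic_on_restrict [simp]: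
  "restrict f A holomorphic_on A \<longleftrightarrow> f holomorphic_on A"
  by (rule holomorphic_cong) auto

lemma holomorphic_hol_fun: "hol_fun f holomorphic_on unit_disk"
  using hol_fun[of f] by simp

lemma hol_fun_extensional: "hol_fun f \<in> extensional unit_disk"
  using hol_fun[of f] by simp

lemma hol_disk_eqI: "(\<And>z. z \<in> unit_disk \<Longrightarrow> hol_fun f z = hol_fun g z) \<Longrightarrow> f = g"
  using hol_fun_extensional extensionalityI hol_fun_inject by metis

instantiation hol_disk :: real_vector
begin

lift_definition zero_hol_disk :: hol_disk is "\<lambda>z\<in>unit_disk. 0"
  by simp

lift_definition plus_hol_disk :: "hol_disk \<Rightarrow> hol_disk \<Rightarrow> hol_disk"
  is "\<lambda>f g. \<lambda>z\<in>unit_disk. f z + g z"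
  by (auto intro!: holomorphic_intros)

lift_definition minus_hol_disk :: "hol_disk \<Rightarrow> hol_disk \<Rightarrow> hol_disk"
  is "\<lambda>f g. \<lambda>z\<in>unit_disk. f z - g z"
  by (auto intro!: holomorphic_intros)

lift_definition uminus_hol_disk :: "hol_disk \<Rightarrow> hol_disk"
  is "\<lambda>f. \<lambda>z\<in>unit_disk. - f z"
  by (auto intro!: holomorphic_intros)

lift_definition scaleR_hol_disk :: "real \<Rightarrow> hol_disk \<Rightarrow> hol_disk"
  is "\<lambda>r f. \<lambda>z\<in>unit_disk. of_real r * f z"
  by (auto intro!: holomorphic_intros)

instance
  by standard
     (rule hol_disk_eqI;
      simp add: zero_hol_disk.rep_eq plus_hol_disk.rep_eq minus_hol_disk.rep_eq
        uminus_hol_disk.rep_eq scaleR_hol_disk.rep_eq algebra_simps)+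

end

text \<open>The topology of uniform convergence on compact subsets of the disk.\<close>

instantiation hol_disk :: topological_space
begin

definition open_hol_disk :: "hol_disk set \<Rightarrow> bool" where
  "open S \<longleftrightarrow> (\<forall>f\<in>S. \<exists>K e. compact K \<and> K \<subseteq> unit_disk \<and> e > 0 \<and>
     (\<forall>g. (\<forall>z\<in>K. cmod (hol_fun g z - hol_fun f z) < e) \<longrightarrow> g \<in> S))"

instance
proof
  show "open (UNIV :: hol_disk set)"
    unfolding open_hol_disk_def
    by (intro ballI exI[of _ "{}"] exI[of _ "1::real"] conjI allI impI UNIV_I) simp_all
next
  fix S T :: "hol_disk set"
  assume ST: "open S" "open T"
  show "open (S \<inter> T)"
    unfolding open_hol_disk_def
  proof
    fix f assume f: "f \<in> S \<inter> T"
    then have "f \<in> S" "f \<in> T" by simp_all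
    obtain K d where K: "compact K" "K \<subseteq> unit_disk" "d > 0"
      "\<forall>g. (\<forall>z\<in>K. cmod (hol_fun g z - hol_fun f z) < d) \<longrightarrow> g \<in> S"
      using ST(1)[unfolded open_hol_disk_def, rule_format, OF \<open>f \<in> S\<close>] by (elim exE conjE)
    obtain L e where L: "compact L" "L \<subseteq> unit_disk" "e > 0"
      "\<forall>g. (\<forall>z\<in>L. cmod (hol_fun g z - hol_fun f z) < e) \<longrightarrow> g \<in> T"
      using ST(2)[unfolded open_hol_disk_def, rule_format, OF \<open>f \<in> T\<close>] by (elim exE conjE)
    show "\<exists>K e. compact K \<and> K \<subseteq> unit_disk \<and> e > 0 \<and>
        (\<forall>g. (\<forall>z\<in>K. cmod (hol_fun g z - hol_fun f z) < e) \<longrightarrow> g \<in> S \<inter> T)"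
    proof (intro exI conjI allI impI IntI)
      show "compact (K \<union> L)" using K(1) L(1) by (rule compact_Un)
      show "K \<union> L \<subseteq> unit_disk" using K(2) L(2) by (rule Un_least)
      show "min d e > 0" using K(3) L(3) by simp
      fix g assume g: "\<forall>z\<in>K \<union> L. cmod (hol_fun g z - hol_fun f z) < min d e"
      show "g \<in> S" by (rule K(4)[rule_format]) (use g in simp)
      show "g \<in> T" by (rule L(4)[rule_format]) (use g in simp)
    qed
  qed
next
  fix \<S> :: "hol_disk set set"
  assume S: "\<forall>S\<in>\<S>. open S"
  show "open (\<Union>\<S>)"
    unfolding open_hol_disk_def
  proof
    fix f assume "f \<in> \<Union>\<S>"
    then obtain S where fS: "S \<in> \<S>" "f \<in> S" by (rule UnionE)
    obtain K e where K: "compact K" "K \<subseteq> unit_disk" "e > 0"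
      "\<forall>g. (\<forall>z\<in>K. cmod (hol_fun g z - hol_fun f z) < e) \<longrightarrow> g \<in> S"
      using S[rule_format, OF fS(1), unfolded open_hol_disk_def, rule_format, OF fS(2)]
      by (elim exE conjE)
    show "\<exists>K e. compact K \<and> K \<subseteq> unit_disk \<and> e > 0 \<and>
        (\<forall>g. (\<forall>z\<in>K. cmod (hol_fun g z - hol_fun f z) < e) \<longrightarrow> g \<in> \<Union>\<S>)"
      using K(1-3) UnionI[OF fS(1) K(4)[rule_format]]
      by (intro exI[of _ K] exI[of _ e] conjI allI impI) simp_all
  qed
qed

end

definition normalized_class :: "hol_disk set" where
  "normalized_class = {f. hol_fun f 0 = 0 \<and> deriv (hol_fun f) 0 = 1}"

definition class_U :: "hol_disk set" where
  "class_U = {f \<in> normalized_class.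
     (\<forall>z\<in>unit_disk - {0}. hol_fun f z \<noteq> 0) \<and>
     (\<forall>z\<in>unit_disk.
        cmod (deriv (hol_fun f) z * (if z = 0 then 1 else z / hol_fun f z)\<^sup>2 - 1) < 1)}"

definition closed_convex_hull :: "'a::{real_vector,topological_space} set \<Rightarrow> 'a set" where
  "closed_convex_hull V = (\<lambda>S. closed S \<and> convex S) hull V"

definition circle_prob_measures :: "complex measure set" where
  "circle_prob_measures = {\<mu>. prob_space \<mu> \<and> sets \<mu> = sets (restrict_space borel (sphere 0 1))}"

end

theory Submission imports Defs begin

text \<open>
  Write \<open>k x z = z / (1 - x * z)\<^sup>2\<close> for the rotated Koebe functions and let \<open>F\<close>
  (\<open>koebe_means\<close> below) be the set of all averages of \<open>k x\<close> over \<open>x\<close> in the circle with respect to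
  a probability measure.  The hull is identified with \<open>F\<close> by two inclusions.

  Every \<open>k x\<close> with \<open>|x| = 1\<close> belongs to the class, since the defining expression equals
  \<open>- (x z)\<^sup>2\<close> for it.  An average is a locally uniform limit of finite convex combinations
  (Riemann sums), so it stays inside each closed convex set that contains the functions averaged
  (\<open>average_mem_closed_convex\<close>).  Hence \<open>F\<close> is contained in the hull.

  Conversely \<open>F\<close> is convex, because measures can be mixed, and closed, because probability measures
  on the circle are weakly sequentially compact (Helly's selection theorem, transported by the angle).
  It remains to see that \<open>F\<close> contains the class.  For a member \<open>f\<close> put \<open>p z = z / f z\<close>; the
  hypothesis reads \<open>|p z - z p' z - 1| < 1\<close>.  As \<open>p\<close> has no zeros, \<open>p = (1 + \<phi>)\<^sup>2\<close> with \<open>\<phi> 0 = 0\<close>.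
  Were \<open>|\<phi>|\<close> to reach 1, then at a first such point Jack's lemma gives \<open>z \<phi>' z = k \<phi> z\<close> with
  real \<open>k \<ge> 1\<close>, and a computation contradicts the hypothesis there.  So \<open>|\<phi>| < 1\<close>, and
  \<open>g = 1 / (1 + \<phi>)\<close> satisfies \<open>f z = z (g z)\<^sup>2\<close>, \<open>g 0 = 1\<close> and \<open>Re g > 1/2\<close>
  (\<open>root_in_right_half_plane\<close>).

  After a dilation, the Herglotz formula makes \<open>g\<close> an average of Cauchy kernels \<open>1 / (1 - x z)\<close>, so
  \<open>z (g z)\<^sup>2\<close> is an iterated average of products \<open>z / ((1 - x z) (1 - y z))\<close>.  Such a product is the
  average over \<open>0 \<le> t \<le> 1\<close> of \<open>k w\<close> with \<open>w = t x + (1 - t) y\<close>, a point of the closed disk; and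
  for \<open>|w| < 1\<close> the Poisson formula in the variable \<open>w\<close> makes \<open>k w\<close> itself a member of \<open>F\<close>.  All
  these averages remain in the closed convex set \<open>F\<close>, and letting the dilation tend to the identity
  gives \<open>f \<in> F\<close>.

  For the extreme points: at the point \<open>z\<^sub>0 = cnj x\<^sub>0 / 2\<close> the real functional \<open>Re (f z\<^sub>0 / z\<^sub>0)\<close> is at most
  4 on \<open>F\<close>, with equality only for \<open>k x\<^sub>0\<close>; so \<open>k x\<^sub>0\<close> is extreme.  Conversely, conditioning the
  representing measure of an extreme \<open>f\<close> on any set of positive measure must reproduce \<open>f\<close>;
  conditioning on small neighbourhoods of a point \<open>x\<^sub>0\<close> of the support shows \<open>f = k x\<^sub>0\<close>.
\<close>

section \<open>Jack's lemma and the square root of z/f\<close>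

text \<open>
  Multiplication by \<open>c\<close> maps the open left half-plane into its closure, so it involves no rotation.
\<close>

lemma nonneg_real_if_left_half_plane:
  fixes c :: complex
  assumes "\<And>v. Re v < 0 \<Longrightarrow> Re (v * c) \<le> 0"
  shows "c = of_real (Re c)" and "Re c \<ge> 0"
proof -
  show "Re c \<ge> 0" using assms[of "-1"] by simp
  have "Im c = 0"
  proof (rule ccontr)
    assume "Im c \<noteq> 0"
    then show False using assms[of "Complex (-1) (- (Re c + 1) / Im c)"] by simp
  qed
  then show "c = of_real (Re c)" by (simp add: complex_eq_iff)
qed

text \<open>
  By the Schwarz lemma the quotient \<open>G \<zeta> = \<phi> (\<zeta> z0) / (\<zeta> \<phi> z0)\<close> is bounded by 1 on the unit disk,
  while \<open>G 1 = 1\<close>.  Hence \<open>Re G\<close> cannot increase when one moves from 1 into the disk, in whichever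
  direction \<open>v\<close> with \<open>Re v < 0\<close>; so the derivative of \<open>G\<close> at 1, which is \<open>k - 1\<close>, is real and
  nonnegative.
\<close>

lemma Jack_lemma:
  assumes hol: "\<phi> holomorphic_on ball 0 1" and "\<phi> 0 = 0" and z0: "norm z0 < 1"
    and less: "\<And>z. norm z < norm z0 \<Longrightarrow> norm (\<phi> z) < norm (\<phi> z0)"
  obtains k :: real where "k \<ge> 1" "z0 * deriv \<phi> z0 = of_real k * \<phi> z0"
proof (cases "z0 = 0")
  case True
  then show ?thesis using that[of 1] \<open>\<phi> 0 = 0\<close> by simp
next
  case False
  have nz: "\<phi> z0 \<noteq> 0" using less[of 0] False \<open>\<phi> 0 = 0\<close> by auto
  define G where "G \<zeta> = \<phi> (\<zeta> * z0) / (\<phi> z0 * \<zeta>)" for \<zeta>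
  have le: "norm (G \<zeta>) \<le> 1" if "norm \<zeta> < 1" for \<zeta>
  proof -
    have "norm (\<phi> (\<zeta> * z0) / \<phi> z0) \<le> norm \<zeta>"
    proof (rule Schwarz_Lemma(1)[where f = "\<lambda>\<zeta>. \<phi> (\<zeta> * z0) / \<phi> z0"])
      have "(\<lambda>\<zeta>. \<phi> (\<zeta> * z0)) holomorphic_on ball 0 1"
      proof (rule holomorphic_on_compose[of "\<lambda>\<zeta>. \<zeta> * z0" _ \<phi>, unfolded o_def])
        show "\<phi> holomorphic_on (\<lambda>\<zeta>. \<zeta> * z0) ` ball 0 1"
          by (rule holomorphic_on_subset[OF hol])
             (use z0 in \<open>auto intro: norm_mult_less[where r = 1 and s = 1, simplified]\<close>)
      qed (intro holomorphic_intros)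
      then show "(\<lambda>\<zeta>. \<phi> (\<zeta> * z0) / \<phi> z0) holomorphic_on ball 0 1"
        using nz by (intro holomorphic_intros)
      show "norm (\<phi> (\<zeta> * z0) / \<phi> z0) < 1" if "norm \<zeta> < 1" for \<zeta>
        using less[of "\<zeta> * z0"] that False nz
        by (simp add: norm_mult norm_divide)
    qed (use \<open>\<phi> 0 = 0\<close> that in auto)
    then show ?thesis
      by (cases "\<zeta> = 0") (use nz in \<open>simp_all add: G_def norm_mult norm_divide field_simps\<close>)
  qed
  define c where "c = z0 * deriv \<phi> z0 / \<phi> z0 - 1"
  have G1: "G 1 = 1" using nz by (simp add: G_def)
  have "(\<phi> has_field_derivative deriv \<phi> z0) (at (1 * z0))"
    using holomorphic_derivI[OF hol open_ball, of z0] z0 by simp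
  then have "((\<lambda>\<zeta>. \<phi> (\<zeta> * z0)) has_field_derivative deriv \<phi> z0 * z0) (at 1)"
    by (rule DERIV_chain2) (auto intro!: derivative_eq_intros)
  then have dG: "(G has_field_derivative c) (at 1)"
    unfolding G_def c_def using nz
    by (auto intro!: derivative_eq_intros simp: field_simps)
  have half: "Re (v * c) \<le> 0" if v: "Re v < 0" for v
  proof (rule ccontr)
    assume "\<not> Re (v * c) \<le> 0"
    have "((\<lambda>s. 1 + of_real s * v) has_vector_derivative v) (at (0::real))"
      by (auto intro!: derivative_eq_intros)
    moreover have "(G has_field_derivative c) (at (1 + of_real (0::real) * v))" using dG by simp
    ultimately have "((G \<circ> (\<lambda>s. 1 + of_real s * v)) has_vector_derivative v * c) (at 0)"
      by (rule field_vector_diff_chain_at)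
    then have "((\<lambda>s. Re (G (1 + of_real s * v))) has_real_derivative Re (v * c)) (at 0)"
      unfolding o_def has_real_derivative_iff_has_vector_derivative
      by (rule bounded_linear.has_vector_derivative[OF bounded_linear_Re])
    then obtain d where d: "d > 0" "\<And>h. 0 < h \<Longrightarrow> h < d \<Longrightarrow> 1 < Re (G (1 + of_real h * v))"
      using DERIV_pos_inc_right[of "\<lambda>s. Re (G (1 + of_real s * v))" "Re (v * c)" 0]
        \<open>\<not> Re (v * c) \<le> 0\<close> G1 by auto
    \<comment> \<open>a step so short that the increase of \<open>Re G\<close> is guaranteed and \<open>1 + h v\<close> is still in the disk\<close>
    define h where "h = min (d / 2) (- Re v / (norm v)\<^sup>2)"
    have vpos: "(norm v)\<^sup>2 > 0" using v by auto
    have h: "0 < h" "h < d" "h * (norm v)\<^sup>2 \<le> - Re v"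
      using d(1) v vpos by (auto simp: h_def min_def field_simps not_le)
    have "(norm (1 + of_real h * v))\<^sup>2 = 1 + h * (2 * Re v + h * (norm v)\<^sup>2)"
      unfolding cmod_power2 by (simp add: power2_eq_square algebra_simps)
    also have "\<dots> < 1" using h v by (simp add: mult_pos_neg)
    finally have "norm (1 + of_real h * v) < 1" by (simp add: power_less_one_iff)
    from le[OF this] d(2)[OF h(1,2)] show False
      using complex_Re_le_cmod[of "G (1 + of_real h * v)"] by linarith
  qed
  show ?thesis
  proof (rule that)
    show "1 + Re c \<ge> 1" using nonneg_real_if_left_half_plane(2)[OF half] by simp
    have "z0 * deriv \<phi> z0 = (1 + c) * \<phi> z0" using nz by (simp add: c_def)
    then show "z0 * deriv \<phi> z0 = of_real (1 + Re c) * \<phi> z0"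
      using nonneg_real_if_left_half_plane(1)[OF half] by simp
  qed
qed

text \<open>
  If \<open>\<phi>\<close> leaves the open unit disk at all, it does so for the first time at a point of minimal
  modulus in a compact set; there its modulus is exactly 1 by continuity.
\<close>

lemma norm_less_one_if_first_touch_impossible:
  fixes \<phi> :: "complex \<Rightarrow> complex"
  assumes cont: "continuous_on (ball 0 1) \<phi>" and "\<phi> 0 = 0"
    and touch: "\<And>z0. norm z0 < 1 \<Longrightarrow> norm (\<phi> z0) = 1 \<Longrightarrow>
      (\<And>z. norm z < norm z0 \<Longrightarrow> norm (\<phi> z) < 1) \<Longrightarrow> False"
    and z: "norm z < 1"
  shows "norm (\<phi> z) < 1"
proof (rule ccontr)
  assume "\<not> norm (\<phi> z) < 1"
  have c: "continuous_on (cball 0 (norm z)) \<phi>"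
    by (rule continuous_on_subset[OF cont]) (use z in auto)
  define K where "K = {w \<in> cball 0 (norm z). norm (\<phi> w) \<ge> 1}"
  have "closed K" unfolding K_def
    by (intro continuous_on_closed_Collect_le continuous_intros c) auto
  then have "compact K" using compact_Int_closed[of "cball 0 (norm z)" K]
    by (simp add: K_def Int_def conj_ac cong: conj_cong)
  moreover have "K \<noteq> {}" using \<open>\<not> norm (\<phi> z) < 1\<close> by (auto simp: K_def intro!: exI[of _ z])
  ultimately obtain z0 where z0: "z0 \<in> K" and min: "\<And>y. y \<in> K \<Longrightarrow> norm z0 \<le> norm y"
    using continuous_attains_inf[of K norm] continuous_on_norm_id by auto
  have less: "norm (\<phi> w) < 1" if "norm w < norm z0" for w
    using min[of w] that z0 by (force simp: K_def)
  have z01: "norm z0 < 1" using z0 z by (auto simp: K_def)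
  have "z0 \<noteq> 0" using z0 \<open>\<phi> 0 = 0\<close> by (auto simp: K_def)
  have "norm (\<phi> z0) \<le> 1"
  proof (rule continuous_le_on_closure[where S = "ball 0 (norm z0)" and f = "\<lambda>w. norm (\<phi> w)"])
    show "continuous_on (closure (ball 0 (norm z0))) (\<lambda>w. norm (\<phi> w))"
      by (intro continuous_on_norm continuous_on_subset[OF cont])
         (use z01 \<open>z0 \<noteq> 0\<close> in auto)
  qed (use less \<open>z0 \<noteq> 0\<close> in \<open>auto intro: less_imp_le\<close>)
  then have "norm (\<phi> z0) = 1" using z0 by (simp add: K_def)
  from touch[OF z01 this less] show False .
qed

text \<open>
  With \<open>\<phi> = s - 1\<close> and \<open>u = \<phi> z0\<close> at a first point where \<open>|u| = 1\<close>, Jack's lemma turns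
  \<open>p - z p' - 1\<close> into \<open>u ((2 - 2 k) + (1 - 2 k) u)\<close>, whose modulus is at least
  \<open>(2 k - 1) - (2 k - 2) = 1\<close>.
\<close>

lemma root_in_right_half_plane:
  assumes hol: "p holomorphic_on ball 0 1" and "p 0 = 1" and nz: "\<And>z. norm z < 1 \<Longrightarrow> p z \<noteq> 0"
    and small: "\<And>z. norm z < 1 \<Longrightarrow> norm (p z - z * deriv p z - 1) < 1"
  obtains s where "s holomorphic_on ball 0 1" "s 0 = 1"
    "\<And>z. norm z < 1 \<Longrightarrow> p z = (s z)\<^sup>2" "\<And>z. norm z < 1 \<Longrightarrow> norm (s z - 1) < 1"
proof -
  obtain s0 where s0: "s0 holomorphic_on ball 0 1" "\<And>z. norm z < 1 \<Longrightarrow> p z = (s0 z)\<^sup>2"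
    by (rule contractible_imp_holomorphic_sqrt[OF hol])
       (use nz in \<open>auto simp: convex_imp_contractible\<close>)
  \<comment> \<open>\<open>s0 0\<close> is 1 or -1; dividing by it selects the branch with value 1 at the origin\<close>
  define s where "s z = s0 z / s0 0" for z
  have s00: "(s0 0)\<^sup>2 = 1" using s0(2)[of 0] \<open>p 0 = 1\<close> by simp
  then have "s0 0 \<noteq> 0" by auto
  have s: "s holomorphic_on ball 0 1" "s 0 = 1" "\<And>z. norm z < 1 \<Longrightarrow> p z = (s z)\<^sup>2"
    using s0 s00 \<open>s0 0 \<noteq> 0\<close>
    by (auto simp: s_def[abs_def] power_divide intro!: holomorphic_intros)
  define \<phi> where "\<phi> z = s z - 1" for z
  have \<phi>: "\<phi> holomorphic_on ball 0 1" "\<phi> 0 = 0"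
    using s by (auto simp: \<phi>_def[abs_def] intro!: holomorphic_intros)
  have p\<phi>: "p z = (1 + \<phi> z)\<^sup>2" if "norm z < 1" for z using s(3)[OF that] by (simp add: \<phi>_def)
  have dp: "deriv p z = 2 * (1 + \<phi> z) * deriv \<phi> z" if z: "norm z < 1" for z
  proof (rule DERIV_imp_deriv)
    have "((\<lambda>z. (1 + \<phi> z)\<^sup>2) has_field_derivative 2 * (1 + \<phi> z) * deriv \<phi> z) (at z)"
      using holomorphic_derivI[OF \<phi>(1) open_ball, of z] z
      by (auto intro!: derivative_eq_intros)
    then show "(p has_field_derivative 2 * (1 + \<phi> z) * deriv \<phi> z) (at z)"
      by (rule DERIV_cong_ev[THEN iffD1, rotated -1])
         (use p\<phi> z in \<open>auto intro!: eventually_mono[OF eventually_nhds_in_open[of "ball 0 1" z]]\<close>)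
  qed
  have "norm (\<phi> z) < 1" if "norm z < 1" for z
  proof (rule norm_less_one_if_first_touch_impossible[where \<phi> = \<phi>])
    fix z0 assume z0: "norm z0 < 1" and 1: "norm (\<phi> z0) = 1"
      and less: "\<And>z. norm z < norm z0 \<Longrightarrow> norm (\<phi> z) < 1"
    obtain k :: real where k: "k \<ge> 1" "z0 * deriv \<phi> z0 = of_real k * \<phi> z0"
      using Jack_lemma[OF \<phi> z0] less 1 by metis
    have "p z0 - z0 * deriv p z0 - 1 = (1 + \<phi> z0)\<^sup>2 - 2 * (1 + \<phi> z0) * (z0 * deriv \<phi> z0) - 1"
      using p\<phi>[OF z0] dp[OF z0] by simp
    also have "\<dots> = \<phi> z0 * (of_real (2 - 2 * k) + of_real (1 - 2 * k) * \<phi> z0)"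
      unfolding k(2) by (simp add: power2_eq_square algebra_simps)
    finally have "norm (p z0 - z0 * deriv p z0 - 1)
        = norm (of_real (1 - 2 * k) * \<phi> z0 + of_real (2 - 2 * k))"
      using 1 by (simp add: norm_mult add.commute)
    also have "\<dots> \<ge> norm (of_real (1 - 2 * k) * \<phi> z0) - norm (of_real (2 - 2 * k) :: complex)"
      by (rule norm_diff_ineq)
    also have "norm (of_real (1 - 2 * k) * \<phi> z0) - norm (of_real (2 - 2 * k) :: complex) = 1"
      using 1 k(1) by (simp add: norm_mult del: of_real_diff of_real_mult)
    finally show False using small[OF z0] by simp
  qed (use holomorphic_on_imp_continuous_on[OF \<phi>(1)] \<phi>(2) that in auto)
  with s show ?thesis using that by (auto simp: \<phi>_def)
qed

lemma Re_inverse_gt_half: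
  assumes "norm (w - 1 :: complex) < 1"
  shows "w \<noteq> 0" "Re (1 / w) > 1/2"
proof -
  show nz: "w \<noteq> 0" using assms by auto
  have "(norm (w - 1))\<^sup>2 < 1" using assms by (simp add: power_less_one_iff)
  then have "(norm w)\<^sup>2 < 2 * Re w"
    unfolding cmod_power2 by (simp add: power2_eq_square algebra_simps)
  then show "Re (1 / w) > 1/2"
    using nz by (simp add: Re_divide' field_simps)
qed

section \<open>Probability measures on the circle\<close>

abbreviation circle :: "complex set" where
  "circle \<equiv> sphere 0 1"

text \<open>
  Normalised arc length, in the parametrisation of \<^const>\<open>circlepath\<close>, so that contour integrals
  over the unit circle become integrals against it.
\<close>

definition arc_measure :: "complex measure" where
  "arc_measure = distr (restrict_space lborel {0..1}) (restrict_space borel circle)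
     (\<lambda>t::real. exp (2 * of_real pi * \<i> * of_real t))"

lemma space_circle_measure: "\<mu> \<in> circle_prob_measures \<Longrightarrow> space \<mu> = circle"
  by (auto simp: circle_prob_measures_def space_restrict_space dest: sets_eq_imp_space_eq)

lemma borel_measurable_circle_measure:
  assumes "\<mu> \<in> circle_prob_measures" and "continuous_on circle f"
  shows "f \<in> borel_measurable \<mu>"
proof -
  have "sets \<mu> = sets (restrict_space borel circle)"
    using assms by (simp add: circle_prob_measures_def)
  from measurable_cong_sets[OF this refl] borel_measurable_continuous_on_restrict[OF assms(2)]
  show ?thesis by blast
qed

lemma integrable_circle_measure:
  fixes f :: "complex \<Rightarrow> complex"
  assumes "\<mu> \<in> circle_prob_measures" and "continuous_on circle f"
  shows "integrable \<mu> f"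
proof -
  interpret prob_space \<mu> using assms(1) by (simp add: circle_prob_measures_def)
  have "bounded (f ` circle)"
    using assms(2) by (intro compact_imp_bounded compact_continuous_image) auto
  then obtain B where "\<forall>x\<in>circle. norm (f x) \<le> B" unfolding bounded_iff ball_simps by blast
  then show ?thesis
    using borel_measurable_circle_measure[OF assms]
    by (intro integrable_const_bound[of _ B]) (auto simp: space_circle_measure[OF assms(1)])
qed

lemma distr_circle_prob_measures:
  assumes "prob_space M" and "\<xi> \<in> borel_measurable M" and "\<And>\<omega>. \<omega> \<in> space M \<Longrightarrow> norm (\<xi> \<omega>) = 1"
  shows "distr M (restrict_space borel circle) \<xi> \<in> circle_prob_measures"
    and "continuous_on circle f \<Longrightarrow>
      (\<integral>x. f x \<partial>distr M (restrict_space borel circle) \<xi>) = (\<integral>\<omega>. (f (\<xi> \<omega>) :: complex) \<partial>M)"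
proof -
  interpret prob_space M by fact
  have m: "\<xi> \<in> measurable M (restrict_space borel circle)"
    using assms by (intro measurable_restrict_space2) auto
  then show "distr M (restrict_space borel circle) \<xi> \<in> circle_prob_measures"
    by (auto simp: circle_prob_measures_def intro: prob_space_distr)
  assume "continuous_on circle f"
  then show "(\<integral>x. f x \<partial>distr M (restrict_space borel circle) \<xi>) = (\<integral>\<omega>. f (\<xi> \<omega>) \<partial>M)"
    using m by (intro integral_distr borel_measurable_continuous_on_restrict)
qed

lemma prob_space_unit_interval: "prob_space (restrict_space lborel {0..1::real})"
  by (intro prob_spaceI) (simp add: space_restrict_space emeasure_restrict_space)

lemma integral_unit_interval:
  fixes f :: "real \<Rightarrow> complex"
  assumes "continuous_on {0..1} f"
  shows "(f has_integral (\<integral>t. f t \<partial>restrict_space lborel {0..1})) {0..1}"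
proof -
  have "set_integrable lborel {0..1} f" by (rule borel_integrable_atLeastAtMost'[OF assms])
  from set_borel_integral_eq_integral[OF this] show ?thesis
    by (simp add: integral_restrict_space set_lebesgue_integral_def has_integral_iff)
qed

lemma arc_measure_circle: "arc_measure \<in> circle_prob_measures"
  unfolding arc_measure_def
  by (rule distr_circle_prob_measures(1)[OF prob_space_unit_interval])
     (auto intro!: borel_measurable_continuous_on_restrict measurable_restrict_space1 borel_measurable_continuous_onI continuous_intros)

lemma has_integral_arc_measure:
  assumes "continuous_on circle h"
  shows "((\<lambda>t. h (exp (2 * of_real pi * \<i> * of_real t))) has_integral
    (\<integral>x. (h x :: complex) \<partial>arc_measure)) {0..1}"
proof -
  have "(\<integral>x. h x \<partial>arc_measure) =
      (\<integral>t. h (exp (2 * of_real pi * \<i> * of_real t)) \<partial>restrict_space lborel {0..1})"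
    unfolding arc_measure_def
    by (rule distr_circle_prob_measures(2)[OF prob_space_unit_interval _ _ assms])
       (auto intro!: measurable_restrict_space1 borel_measurable_continuous_onI continuous_intros)
  moreover have "continuous_on {0..1} (\<lambda>t. h (exp (2 * of_real pi * \<i> * of_real t)))"
    by (rule continuous_on_compose2[OF assms]) (auto intro!: continuous_intros)
  ultimately show ?thesis using integral_unit_interval by simp
qed

lemma one_minus_mult_nonzero:
  assumes "norm w < 1" "norm x \<le> 1"
  shows "1 - x * w \<noteq> (0::complex)"
proof
  assume "1 - x * w = 0"
  then have "norm (x * w) = 1" by (metis eq_iff_diff_eq_0 norm_one)
  moreover have "norm (x * w) < 1"
    using assms mult_left_le[of "norm x" "norm w"] by (simp add: norm_mult mult.commute)
  ultimately show False by simp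
qed

section \<open>The Poisson and Herglotz formulas on the closed disk\<close>

text \<open>
  Cauchy's integral formula: on the circle \<open>x / (x - w) = 1 / (1 - cnj x * w)\<close>, since
  \<open>x * cnj x = 1\<close>.
\<close>

lemma arc_measure_Cauchy:
  assumes "h holomorphic_on cball 0 1" and w: "norm w < 1"
  shows "(\<integral>x. h x / (1 - cnj x * w) \<partial>arc_measure) = h w"
proof -
  let ?e = "\<lambda>t. exp (2 * of_real pi * \<i> * of_real t) :: complex"
  have e: "cnj (?e t) * ?e t = 1" "?e t \<noteq> 0" for t
    by (simp_all add: exp_cnj flip: exp_add)
  have "((\<lambda>u. h u / (u - w)) has_contour_integral (2 * of_real pi * \<i> * h w)) (circlepath 0 1)"
    using Cauchy_integral_circlepath_simple[of h 0 1 w] assms by simp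
  then have "((\<lambda>t. h (?e t) / (?e t - w) * (2 * of_real pi * \<i> * ?e t))
      has_integral 2 * of_real pi * \<i> * h w) {0..1}"
    unfolding has_contour_integral vector_derivative_circlepath by (simp add: circlepath)
  from has_integral_mult_right[OF this, of "1 / (2 * of_real pi * \<i>)"]
  have "((\<lambda>t. h (?e t) / (?e t - w) * ?e t) has_integral h w) {0..1}"
    by (simp add: field_simps)
  moreover have "h (?e t) / (?e t - w) * ?e t = h (?e t) / (1 - cnj (?e t) * w)" for t
  proof -
    have "?e t - w = ?e t * (1 - cnj (?e t) * w)"
      using e[of t] by (simp add: algebra_simps)
    then show ?thesis using e(2)[of t] by simp
  qed
  ultimately have "((\<lambda>t. h (?e t) / (1 - cnj (?e t) * w)) has_integral h w) {0..1}" by simp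
  moreover have "continuous_on circle (\<lambda>x. h x / (1 - cnj x * w))"
    by (intro continuous_intros continuous_on_subset[OF holomorphic_on_imp_continuous_on[OF assms(1)]])
       (use one_minus_mult_nonzero[OF w, of "cnj _"] in auto)
  ultimately show ?thesis
    using has_integral_arc_measure has_integral_unique by blast
qed

lemma arc_measure_mean_value:
  assumes "h holomorphic_on cball 0 1"
  shows "(\<integral>x. h x \<partial>arc_measure) = h 0"
  using arc_measure_Cauchy[OF assms, of 0] by simp

lemma density_circle_prob_measure:
  assumes \<mu>: "\<mu> \<in> circle_prob_measures" and u: "continuous_on circle u"
    and pos: "\<And>x. x \<in> circle \<Longrightarrow> u x \<ge> 0" and one: "(\<integral>x. of_real (u x) \<partial>\<mu>) = (1::complex)"
  shows "density \<mu> (\<lambda>x. ennreal (u x)) \<in> circle_prob_measures"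
    and "continuous_on circle f \<Longrightarrow>
      (\<integral>x. f x \<partial>density \<mu> (\<lambda>x. ennreal (u x))) = (\<integral>x. of_real (u x) * (f x :: complex) \<partial>\<mu>)"
proof -
  have um: "u \<in> borel_measurable \<mu>" by (rule borel_measurable_circle_measure[OF \<mu> u])
  have "integrable \<mu> (\<lambda>x. Re (of_real (u x)))"
    by (intro integrable_Re integrable_circle_measure[OF \<mu>] continuous_intros u)
  then have int: "integrable \<mu> u" by simp
  have ae: "AE x in \<mu>. 0 \<le> u x" using pos space_circle_measure[OF \<mu>] by auto
  have "(\<integral>x. u x \<partial>\<mu>) = 1" using one by (simp only: integral_complex_of_real of_real_eq_1_iff)
  then have "(\<integral>\<^sup>+x. ennreal (u x) \<partial>\<mu>) = 1" using nn_integral_eq_integral[OF int ae] by simp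
  then have "prob_space (density \<mu> (\<lambda>x. ennreal (u x)))"
    using um by (intro prob_spaceI) (auto simp: emeasure_density cong: nn_integral_cong)
  then show "density \<mu> (\<lambda>x. ennreal (u x)) \<in> circle_prob_measures"
    using \<mu> by (simp add: circle_prob_measures_def)
  assume "continuous_on circle f"
  then show "(\<integral>x. f x \<partial>density \<mu> (\<lambda>x. ennreal (u x))) = (\<integral>x. of_real (u x) * f x \<partial>\<mu>)"
    using integral_density[OF borel_measurable_circle_measure[OF \<mu> \<open>continuous_on circle f\<close>] um ae]
    by (simp add: scaleR_conv_of_real)
qed

text \<open>
  The representing density is \<open>u = 2 Re g - 1 = g + cnj g - 1\<close>, nonnegative by hypothesis.  Against
  the kernel \<open>1 / (1 - cnj x * z)\<close> the term \<open>g\<close> gives \<open>g z\<close> by Cauchy's formula, the term 1 gives 1,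
  and the conjugated term also gives 1: it is the conjugate of the mean of the holomorphic function
  \<open>g x / (1 - x * cnj z)\<close>, whose value at the origin is 1.
\<close>

lemma Herglotz_on_closed_disk:
  assumes hol: "g holomorphic_on cball 0 1" and "g 0 = 1" and pos: "\<And>x. norm x = 1 \<Longrightarrow> Re (g x) \<ge> 1/2"
  obtains \<nu> where "\<nu> \<in> circle_prob_measures"
    "\<forall>z. norm z < 1 \<longrightarrow> g z = (\<integral>x. 1 / (1 - cnj x * z) \<partial>\<nu>)"
proof -
  note \<sigma> = arc_measure_circle
  note int = integrable_circle_measure[OF \<sigma>]
  have cg: "continuous_on circle g"
    using holomorphic_on_imp_continuous_on[OF hol] by (rule continuous_on_subset) auto
  define u where "u x = 2 * Re (g x) - 1" for x
  have u: "of_real (u x) = g x + cnj (g x) - 1" for x by (simp add: u_def complex_eq_iff)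
  have cu: "continuous_on circle u" unfolding u_def by (intro continuous_intros cg)
  have kernel: "(\<integral>x. of_real (u x) * (1 / (1 - cnj x * z)) \<partial>arc_measure) = g z"
    if z: "norm z < 1" for z
  proof -
    have nz: "1 - cnj x * z \<noteq> 0" "1 - x * cnj z \<noteq> 0" if "norm x \<le> 1" for x
      using one_minus_mult_nonzero[of z "cnj x"] one_minus_mult_nonzero[of "cnj z" x] z that by auto
    have ck: "continuous_on circle (\<lambda>x. 1 / (1 - cnj x * z))"
      by (intro continuous_intros) (use nz in auto)
    have 1: "continuous_on circle (\<lambda>x. g x / (1 - cnj x * z))"
      by (intro continuous_intros cg) (use nz in auto)
    have 2: "continuous_on circle (\<lambda>x. cnj (g x / (1 - x * cnj z)))"
      by (intro continuous_intros cg) (use nz in auto)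
    have "(\<integral>x. of_real (u x) * (1 / (1 - cnj x * z)) \<partial>arc_measure) =
        (\<integral>x. g x / (1 - cnj x * z) + cnj (g x / (1 - x * cnj z)) - 1 / (1 - cnj x * z) \<partial>arc_measure)"
      by (simp add: u add_divide_distrib diff_divide_distrib)
    also have "\<dots> = (\<integral>x. g x / (1 - cnj x * z) \<partial>arc_measure)
        + (\<integral>x. cnj (g x / (1 - x * cnj z)) \<partial>arc_measure) - (\<integral>x. 1 / (1 - cnj x * z) \<partial>arc_measure)"
      by (simp only: Bochner_Integration.integral_add Bochner_Integration.integral_diff
          Bochner_Integration.integrable_add int[OF 1] int[OF 2] int[OF ck])
    also have "(\<integral>x. cnj (g x / (1 - x * cnj z)) \<partial>arc_measure) = cnj (\<integral>x. g x / (1 - x * cnj z) \<partial>arc_measure)"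
      by (rule Bochner_Integration.integral_cnj)
    also have "(\<integral>x. g x / (1 - x * cnj z) \<partial>arc_measure) = 1"
      by (subst arc_measure_mean_value)
         (use hol nz \<open>g 0 = 1\<close> in \<open>auto intro!: holomorphic_intros\<close>)
    also have "(\<integral>x. 1 / (1 - cnj x * z) \<partial>arc_measure) = 1"
      by (rule arc_measure_Cauchy[of "\<lambda>_. 1"]) (use z in auto)
    also have "(\<integral>x. g x / (1 - cnj x * z) \<partial>arc_measure) = g z"
      by (rule arc_measure_Cauchy[OF hol z])
    finally show ?thesis by simp
  qed
  have one: "(\<integral>x. of_real (u x) \<partial>arc_measure) = (1::complex)" using kernel[of 0] \<open>g 0 = 1\<close> by simp
  have upos: "u x \<ge> 0" if "x \<in> circle" for x using pos[of x] that by (simp add: u_def)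
  note d = density_circle_prob_measure[OF \<sigma> cu upos one]
  show ?thesis
  proof (rule that[OF d(1)], safe)
    fix z :: complex assume z: "norm z < 1"
    have "continuous_on circle (\<lambda>x. 1 / (1 - cnj x * z))"
      by (intro continuous_intros) (use one_minus_mult_nonzero[OF z, of "cnj _"] in auto)
    from d(2)[OF _ this] kernel[OF z]
    show "g z = (\<integral>x. 1 / (1 - cnj x * z) \<partial>density arc_measure (\<lambda>x. ennreal (u x)))" by simp
  qed
qed

text \<open>
  The density \<open>2 Re (1 / (1 - x * cnj w)) - 1\<close> is the Poisson kernel.  Of its three terms the first
  reproduces \<open>H w\<close>, and the other two give \<open>H 0\<close> with opposite signs by the mean value property.
\<close>

lemma Poisson_on_closed_disk:
  assumes w: "norm w < 1"
  obtains \<nu> where "\<nu> \<in> circle_prob_measures"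
    "\<And>H. H holomorphic_on cball 0 1 \<Longrightarrow> H w = (\<integral>x. H x \<partial>\<nu>)"
proof -
  note \<sigma> = arc_measure_circle
  note int = integrable_circle_measure[OF \<sigma>]
  define u where "u x = 2 * Re (1 / (1 - x * cnj w)) - 1" for x
  have u: "of_real (u x) = 1 / (1 - cnj x * w) + 1 / (1 - x * cnj w) - 1" for x
  proof -
    have "cnj (1 / (1 - x * cnj w)) = 1 / (1 - cnj x * w)" by simp
    then show ?thesis
      using complex_add_cnj[of "1 / (1 - x * cnj w)"] by (simp add: u_def add.commute)
  qed
  have nz: "1 - cnj x * w \<noteq> 0" "1 - x * cnj w \<noteq> 0" if "norm x \<le> 1" for x
    using one_minus_mult_nonzero[of w "cnj x"] one_minus_mult_nonzero[of "cnj w" x] w that by auto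
  have cu: "continuous_on circle u"
    unfolding u_def by (intro continuous_intros) (use nz in auto)
  have upos: "u x \<ge> 0" if "x \<in> circle" for x
  proof -
    have "norm (x * cnj w) < 1" using that w by (simp add: norm_mult)
    then show ?thesis using Re_inverse_gt_half(2)[of "1 - x * cnj w"] by (simp add: u_def)
  qed
  have kernel: "(\<integral>x. of_real (u x) * H x \<partial>arc_measure) = H w"
    if H: "H holomorphic_on cball 0 1" for H
  proof -
    have cH: "continuous_on circle H"
      using holomorphic_on_imp_continuous_on[OF H] by (rule continuous_on_subset) auto
    have 1: "continuous_on circle (\<lambda>x. H x / (1 - cnj x * w))"
      and 2: "continuous_on circle (\<lambda>x. H x / (1 - x * cnj w))"
      by (intro continuous_intros cH; use nz in auto)+
    have "(\<integral>x. of_real (u x) * H x \<partial>arc_measure) =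
        (\<integral>x. H x / (1 - cnj x * w) + H x / (1 - x * cnj w) - H x \<partial>arc_measure)"
      by (simp add: u algebra_simps)
    also have "\<dots> = (\<integral>x. H x / (1 - cnj x * w) \<partial>arc_measure)
        + (\<integral>x. H x / (1 - x * cnj w) \<partial>arc_measure) - (\<integral>x. H x \<partial>arc_measure)"
      by (simp only: Bochner_Integration.integral_add Bochner_Integration.integral_diff
          Bochner_Integration.integrable_add int[OF 1] int[OF 2] int[OF cH])
    also have "(\<integral>x. H x / (1 - x * cnj w) \<partial>arc_measure) = H 0"
      by (subst arc_measure_mean_value) (use H nz in \<open>auto intro!: holomorphic_intros\<close>)
    also have "(\<integral>x. H x \<partial>arc_measure) = H 0"
      by (rule arc_measure_mean_value[OF H])
    also have "(\<integral>x. H x / (1 - cnj x * w) \<partial>arc_measure) = H w"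
      by (rule arc_measure_Cauchy[OF H w])
    finally show ?thesis by simp
  qed
  have one: "(\<integral>x. of_real (u x) \<partial>arc_measure) = (1::complex)" using kernel[of "\<lambda>_. 1"] by simp
  note d = density_circle_prob_measure[OF \<sigma> cu upos one]
  show ?thesis
  proof (rule that[OF d(1)])
    fix H assume H: "H holomorphic_on cball 0 1"
    have "continuous_on circle H"
      using holomorphic_on_imp_continuous_on[OF H] by (rule continuous_on_subset) auto
    from d(2)[OF _ this] kernel[OF H]
    show "H w = (\<integral>x. H x \<partial>density arc_measure (\<lambda>x. ennreal (u x)))" by simp
  qed
qed

section \<open>Weak compactness and mixtures of measures on the circle\<close>

text \<open>
  A measurable bounded inverse of \<^const>\<open>cis\<close>; it carries measures on the circle to measures on the
  real line, where Helly's selection theorem applies.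
\<close>

lemma measure_circle_angle:
  assumes \<mu>: "\<mu> \<in> circle_prob_measures"
  obtains \<theta> where "\<theta> \<in> borel_measurable \<mu>"
    "\<And>x. norm x = 1 \<Longrightarrow> cis (\<theta> x) = x" "\<And>x. norm x = 1 \<Longrightarrow> \<theta> x \<in> {-pi..pi}"
proof
  define \<theta> where "\<theta> x = (if Im x \<ge> 0 then arccos (Re x) else - arccos (Re x))" for x
  have Re: "\<bar>Re x\<bar> \<le> 1" if "norm x = 1" for x using abs_Re_le_cmod[of x] that by simp
  have c: "continuous_on circle (\<lambda>x. arccos (Re x))"
    by (intro continuous_intros) (use Re in \<open>auto simp: abs_le_iff\<close>)
  have [measurable]: "Im \<in> borel_measurable \<mu>" "(\<lambda>x. arccos (Re x)) \<in> borel_measurable \<mu>"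
    by (intro borel_measurable_circle_measure[OF \<mu>] c continuous_intros)+
  show "\<theta> \<in> borel_measurable \<mu>" unfolding \<theta>_def by measurable
  fix x :: complex assume x: "norm x = 1"
  have "sqrt (1 - (Re x)\<^sup>2) = \<bar>Im x\<bar>"
  proof -
    have "1 - (Re x)\<^sup>2 = (Im x)\<^sup>2" using cmod_power2[of x] x by simp
    then show ?thesis by simp
  qed
  then show "cis (\<theta> x) = x" using Re[OF x]
    by (auto simp: \<theta>_def complex_eq_iff sin_arccos_abs abs_le_iff)
  show "\<theta> x \<in> {-pi..pi}" using Re[OF x] arccos_bounded[of "Re x"]
    by (auto simp: \<theta>_def abs_le_iff)
qed

text \<open>
  The angular distributions all live in a bounded interval, so they are tight and a subsequence
  converges weakly; the limit is wrapped back onto the circle.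
\<close>

lemma circle_prob_measures_weakly_compact:
  assumes \<mu>: "\<And>n. \<mu> n \<in> circle_prob_measures"
  obtains r \<nu> where "strict_mono (r :: nat \<Rightarrow> nat)" "\<nu> \<in> circle_prob_measures"
    "\<And>f :: complex \<Rightarrow> complex. continuous_on circle f \<Longrightarrow>
      (\<lambda>n. \<integral>x. f x \<partial>\<mu> (r n)) \<longlonglongrightarrow> (\<integral>x. f x \<partial>\<nu>)"
proof -
  have "\<exists>\<theta>. \<theta> \<in> borel_measurable (\<mu> n) \<and> (\<forall>x. norm x = 1 \<longrightarrow> cis (\<theta> x) = x \<and> \<theta> x \<in> {-pi..pi})" for n
    using measure_circle_angle[OF \<mu>[of n]] by metis
  then obtain \<theta> where \<theta>: "\<And>n. \<theta> n \<in> borel_measurable (\<mu> n)"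
    "\<And>n x. norm x = 1 \<Longrightarrow> cis (\<theta> n x) = x" "\<And>n x. norm x = 1 \<Longrightarrow> \<theta> n x \<in> {-pi..pi}"
    by metis
  define N where "N n = distr (\<mu> n) borel (\<theta> n)" for n
  have rd: "real_distribution (N n)" for n
    unfolding N_def using \<mu>[of n] \<theta>(1)
    by (intro prob_space.real_distribution_distr) (auto simp: circle_prob_measures_def)
  have "tight N"
    unfolding tight_def
  proof (intro conjI allI impI rd)
    fix e :: real assume "e > 0"
    \<comment> \<open>the bounds \<open>-4\<close> and 4 merely enclose \<open>[-\<pi>, \<pi>]\<close>\<close>
    have "measure (N n) {-4<..4} = 1" for n
    proof -
      interpret prob_space "\<mu> n" using \<mu>[of n] by (simp add: circle_prob_measures_def)
      have "\<theta> n -` {-4<..4} \<inter> space (\<mu> n) = space (\<mu> n)"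
        using \<theta>(3)[of _ n] pi_less_4 by (force simp: space_circle_measure[OF \<mu>])
      then show ?thesis unfolding N_def by (simp add: measure_distr \<theta>(1) prob_space)
    qed
    then show "\<exists>a b. a < b \<and> (\<forall>n. 1 - e < measure (N n) {a<..b})"
      using \<open>e > 0\<close> by (intro exI[of _ "-4"] exI[of _ 4]) auto
  qed
  from tight_imp_convergent_subsubsequence[OF this strict_mono_id]
  obtain r L where r: "strict_mono r" and L: "real_distribution L"
    and conv: "weak_conv_m (N \<circ> r) L" by (auto simp: o_def)
  interpret L: real_distribution L by fact
  define \<nu> where "\<nu> = distr L (restrict_space borel circle) cis"
  have cis_meas: "cis \<in> borel_measurable L"
    by (simp add: borel_measurable_continuous_onI continuous_on_cis)
  show ?thesis
  proof (rule that[OF r])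
    show "\<nu> \<in> circle_prob_measures" unfolding \<nu>_def
      by (rule distr_circle_prob_measures(1)[OF L.prob_space_axioms cis_meas]) simp
    fix f :: "complex \<Rightarrow> complex" assume f: "continuous_on circle f"
    have cf: "continuous_on UNIV (\<lambda>t. f (cis t))"
      by (rule continuous_on_compose2[OF f]) (auto intro!: continuous_on_cis continuous_intros)
    have "bounded (f ` circle)"
      using f by (intro compact_imp_bounded compact_continuous_image) auto
    then obtain B where B: "\<forall>x\<in>circle. norm (f x) \<le> B" unfolding bounded_iff ball_simps by blast
    have "(\<lambda>n. \<integral>t. f (cis t) \<partial>(N \<circ> r) n) \<longlonglongrightarrow> (\<integral>t. f (cis t) \<partial>L)"
    proof (rule weak_conv_imp_integral_bdd_continuous_conv[OF _ L conv])
      show "isCont (\<lambda>t. f (cis t)) t" for t using cf by (simp add: continuous_on_eq_continuous_at)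
      show "norm (f (cis t)) \<le> B" for t using B by simp
    qed (simp add: rd)
    moreover have "(\<integral>t. f (cis t) \<partial>(N \<circ> r) n) = (\<integral>x. f x \<partial>\<mu> (r n))" for n
    proof -
      have "(\<integral>t. f (cis t) \<partial>(N \<circ> r) n) = (\<integral>x. f (cis (\<theta> (r n) x)) \<partial>\<mu> (r n))"
        unfolding N_def o_def
        by (rule integral_distr[OF \<theta>(1) borel_measurable_continuous_onI[OF cf]])
      also have "\<dots> = (\<integral>x. f x \<partial>\<mu> (r n))"
        by (rule Bochner_Integration.integral_cong) (simp_all add: space_circle_measure[OF \<mu>] \<theta>(2))
      finally show ?thesis .
    qed
    moreover have "(\<integral>x. f x \<partial>\<nu>) = (\<integral>t. f (cis t) \<partial>L)" unfolding \<nu>_def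
      by (rule distr_circle_prob_measures(2)[OF L.prob_space_axioms cis_meas _ f]) simp
    ultimately show "(\<lambda>n. \<integral>x. f x \<partial>\<mu> (r n)) \<longlonglongrightarrow> (\<integral>x. f x \<partial>\<nu>)" by simp
  qed
qed

text \<open>
  The mixture is the law of the point obtained by tossing a coin with success probability \<open>p\<close> and
  then reading off the first or the second of two independent points with laws \<open>\<mu>\<close> and \<open>\<nu>\<close>.
\<close>

lemma circle_prob_measure_mixture:
  assumes \<mu>: "\<mu> \<in> circle_prob_measures" and \<nu>: "\<nu> \<in> circle_prob_measures" and p: "0 \<le> p" "p \<le> 1"
  obtains \<rho> where "\<rho> \<in> circle_prob_measures"
    "\<And>f :: complex \<Rightarrow> complex. continuous_on circle f \<Longrightarrow>
      (\<integral>x. f x \<partial>\<rho>) = of_real p * (\<integral>x. f x \<partial>\<mu>) + of_real (1 - p) * (\<integral>x. f x \<partial>\<nu>)"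
proof -
  interpret \<mu>: prob_space \<mu> using \<mu> by (simp add: circle_prob_measures_def)
  interpret \<nu>: prob_space \<nu> using \<nu> by (simp add: circle_prob_measures_def)
  interpret P: pair_prob_space \<mu> \<nu> ..
  define b where "b = measure_pmf (bernoulli_pmf p)"
  interpret b: prob_space b unfolding b_def by (rule prob_space_measure_pmf)
  interpret Q: pair_prob_space b "\<mu> \<Otimes>\<^sub>M \<nu>" ..
  define \<xi> where "\<xi> = (\<lambda>(c, xy). if c then fst xy else snd xy :: complex)"
  have id: "(\<lambda>x. x) \<in> borel_measurable \<mu>" "(\<lambda>x. x) \<in> borel_measurable \<nu>"
    by (intro borel_measurable_circle_measure \<mu> \<nu> continuous_intros)+
  have fst_m: "fst \<in> borel_measurable (\<mu> \<Otimes>\<^sub>M \<nu>)" and snd_m: "snd \<in> borel_measurable (\<mu> \<Otimes>\<^sub>M \<nu>)"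
    using measurable_compose[OF measurable_fst id(1)] measurable_compose[OF measurable_snd id(2)] by auto
  have [measurable]: "Measurable.pred (b \<Otimes>\<^sub>M (\<mu> \<Otimes>\<^sub>M \<nu>)) fst"
    by (rule measurable_compose[OF measurable_fst]) (simp add: b_def)
  have [measurable]: "(\<lambda>w. fst (snd w)) \<in> borel_measurable (b \<Otimes>\<^sub>M (\<mu> \<Otimes>\<^sub>M \<nu>))"
      "(\<lambda>w. snd (snd w)) \<in> borel_measurable (b \<Otimes>\<^sub>M (\<mu> \<Otimes>\<^sub>M \<nu>))"
    using measurable_compose[OF measurable_snd fst_m] measurable_compose[OF measurable_snd snd_m] by auto
  have \<xi>: "\<xi> \<in> borel_measurable (b \<Otimes>\<^sub>M (\<mu> \<Otimes>\<^sub>M \<nu>))"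
    unfolding \<xi>_def case_prod_beta by measurable
  have \<xi>1: "norm (\<xi> \<omega>) = 1" if "\<omega> \<in> space (b \<Otimes>\<^sub>M (\<mu> \<Otimes>\<^sub>M \<nu>))" for \<omega>
    using that by (auto simp: \<xi>_def space_pair_measure space_circle_measure[OF \<mu>] space_circle_measure[OF \<nu>])
  note d = distr_circle_prob_measures[OF Q.prob_space_axioms \<xi> \<xi>1]
  show ?thesis
  proof (rule that[OF d(1)])
    fix f :: "complex \<Rightarrow> complex" assume f: "continuous_on circle f"
    have "integrable (distr (b \<Otimes>\<^sub>M (\<mu> \<Otimes>\<^sub>M \<nu>)) (restrict_space borel circle) \<xi>) f"
      by (rule integrable_circle_measure[OF d(1) f])
    then have int: "integrable (b \<Otimes>\<^sub>M (\<mu> \<Otimes>\<^sub>M \<nu>)) (\<lambda>\<omega>. f (\<xi> \<omega>))"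
      by (rule integrable_distr[rotated]) (intro measurable_restrict_space2 \<xi>, use \<xi>1 in auto)
    have marginals: "(\<integral>w. f (fst w) \<partial>(\<mu> \<Otimes>\<^sub>M \<nu>)) = (\<integral>x. f x \<partial>\<mu>)"
      "(\<integral>w. f (snd w) \<partial>(\<mu> \<Otimes>\<^sub>M \<nu>)) = (\<integral>x. f x \<partial>\<nu>)"
    proof -
      show "(\<integral>w. f (fst w) \<partial>(\<mu> \<Otimes>\<^sub>M \<nu>)) = (\<integral>x. f x \<partial>\<mu>)"
        using integral_distr[OF measurable_fst borel_measurable_circle_measure[OF \<mu> f], of \<nu>]
        by (simp add: \<nu>.distr_pair_fst)
      show "(\<integral>w. f (snd w) \<partial>(\<mu> \<Otimes>\<^sub>M \<nu>)) = (\<integral>x. f x \<partial>\<nu>)"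
        using integral_distr[OF measurable_fst borel_measurable_circle_measure[OF \<nu> f], of \<mu>]
          P.integral_product_swap[of "\<lambda>w. f (snd w)"]
          measurable_compose[OF measurable_snd borel_measurable_circle_measure[OF \<nu> f], of \<mu>]
        by (simp add: \<mu>.distr_pair_fst case_prod_beta')
    qed
    have "(\<integral>x. f x \<partial>distr (b \<Otimes>\<^sub>M (\<mu> \<Otimes>\<^sub>M \<nu>)) (restrict_space borel circle) \<xi>)
        = (\<integral>\<omega>. f (\<xi> \<omega>) \<partial>(b \<Otimes>\<^sub>M (\<mu> \<Otimes>\<^sub>M \<nu>)))"
      by (rule d(2)[OF _ f])
    also have "\<dots> = (\<integral>c. (\<integral>w. f (\<xi> (c, w)) \<partial>(\<mu> \<Otimes>\<^sub>M \<nu>)) \<partial>b)"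
      by (rule Q.integral_fst'[OF int, symmetric])
    also have "\<dots> = of_real p * (\<integral>w. f (fst w) \<partial>(\<mu> \<Otimes>\<^sub>M \<nu>)) + of_real (1 - p) * (\<integral>w. f (snd w) \<partial>(\<mu> \<Otimes>\<^sub>M \<nu>))"
      unfolding b_def using p
      by (subst integral_measure_pmf[of UNIV]) (auto simp: UNIV_bool \<xi>_def scaleR_conv_of_real)
    finally show "(\<integral>x. f x \<partial>distr (b \<Otimes>\<^sub>M (\<mu> \<Otimes>\<^sub>M \<nu>)) (restrict_space borel circle) \<xi>)
        = of_real p * (\<integral>x. f x \<partial>\<mu>) + of_real (1 - p) * (\<integral>x. f x \<partial>\<nu>)"
      unfolding marginals .
  qed
qed

lemma continuous_on_koebe_kernel:
  fixes z :: complex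
  assumes "norm z < 1" "T \<subseteq> cball 0 1"
  shows "continuous_on T (\<lambda>x. z / (1 - x * z)\<^sup>2)"
  by (intro continuous_intros) (use assms one_minus_mult_nonzero in \<open>auto simp: subset_iff\<close>)

text \<open>
  Integrating the expansion \<open>1 / (1 - x z)\<^sup>2 = (\<Sum>n. (n + 1) x\<^sup>n z\<^sup>n)\<close> term by term gives a power series
  whose coefficients are the moments of \<open>\<mu>\<close>.
\<close>

lemma holomorphic_koebe_mean:
  assumes \<mu>: "\<mu> \<in> circle_prob_measures"
  shows "(\<lambda>z. \<integral>x. z / (1 - x * z)\<^sup>2 \<partial>\<mu>) holomorphic_on ball 0 1"
proof -
  interpret prob_space \<mu> using \<mu> by (simp add: circle_prob_measures_def)
  have "(\<lambda>n. (of_nat (Suc n) * (\<integral>x. x ^ n \<partial>\<mu>)) * (z - 0) ^ n) sums (\<integral>x. 1 / (1 - x * z)\<^sup>2 \<partial>\<mu>)"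
    if "z \<in> ball 0 1" for z
  proof -
    have z: "norm z < 1" using that by simp
    define f where "f n x = of_nat (Suc n) * (x * z) ^ n" for n x
    have norm_f: "norm (f n x) = of_nat (Suc n) * norm z ^ n" if "x \<in> space \<mu>" for n x
      using that by (simp add: f_def norm_mult norm_power power_mult_distrib space_circle_measure[OF \<mu>] del: of_nat_Suc)
    have summ: "summable (\<lambda>n. of_nat (Suc n) * norm z ^ n)"
      using geometric_deriv_sums[of "norm z"] z by (simp add: sums_iff)
    have "(\<lambda>n. \<integral>x. f n x \<partial>\<mu>) sums (\<integral>x. (\<Sum>n. f n x) \<partial>\<mu>)"
    proof (rule sums_integral)
      show "integrable \<mu> (f n)" for n
        unfolding f_def by (intro integrable_circle_measure[OF \<mu>] continuous_intros)
      show "AE x in \<mu>. summable (\<lambda>n. norm (f n x))" using norm_f summ by simp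
      have "(\<integral>x. norm (f n x) \<partial>\<mu>) = of_nat (Suc n) * norm z ^ n" for n
        using Bochner_Integration.integral_cong[OF refl norm_f, of \<mu>] prob_space by simp
      then show "summable (\<lambda>n. \<integral>x. norm (f n x) \<partial>\<mu>)" using summ by simp
    qed
    moreover have "(\<Sum>n. f n x) = 1 / (1 - x * z)\<^sup>2" if "x \<in> space \<mu>" for x
      using geometric_deriv_sums[of "x * z"] that z
      by (simp add: f_def sums_iff norm_mult space_circle_measure[OF \<mu>])
    then have "(\<integral>x. (\<Sum>n. f n x) \<partial>\<mu>) = (\<integral>x. 1 / (1 - x * z)\<^sup>2 \<partial>\<mu>)"
      by (intro Bochner_Integration.integral_cong) auto
    moreover have "(\<integral>x. f n x \<partial>\<mu>) = (of_nat (Suc n) * (\<integral>x. x ^ n \<partial>\<mu>)) * (z - 0) ^ n" for n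
      by (simp add: f_def power_mult_distrib flip: mult.assoc)
    ultimately show ?thesis by simp
  qed
  then have "(\<lambda>z. \<integral>x. 1 / (1 - x * z)\<^sup>2 \<partial>\<mu>) holomorphic_on ball 0 1"
    by (rule power_series_holomorphic)
  then have "(\<lambda>z. z * (\<integral>x. 1 / (1 - x * z)\<^sup>2 \<partial>\<mu>)) holomorphic_on ball 0 1"
    by (intro holomorphic_intros)
  moreover have "z * (\<integral>x. 1 / (1 - x * z)\<^sup>2 \<partial>\<mu>) = (\<integral>x. z / (1 - x * z)\<^sup>2 \<partial>\<mu>)" for z
    by (simp flip: integral_mult_right_zero)
  ultimately show ?thesis by simp
qed

section \<open>Averages in the space of analytic functions\<close>

definition disk_restrict :: "(complex \<Rightarrow> complex) \<Rightarrow> hol_disk" where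
  "disk_restrict h = Abs_hol_disk (restrict h unit_disk)"

lemma hol_fun_disk_restrict:
  "h holomorphic_on unit_disk \<Longrightarrow> z \<in> unit_disk \<Longrightarrow> hol_fun (disk_restrict h) z = h z"
  by (simp add: disk_restrict_def Abs_hol_disk_inverse)

lemma hol_fun_eq_restrictI:
  "(\<And>z. z \<in> unit_disk \<Longrightarrow> hol_fun f z = h z) \<Longrightarrow> hol_fun f = restrict h unit_disk"
  using hol_fun_extensional[of f] by (auto simp: fun_eq_iff extensional_def restrict_def)

lemma hol_fun_add: "z \<in> unit_disk \<Longrightarrow> hol_fun (f + g) z = hol_fun f z + hol_fun g z"
  by (simp add: plus_hol_disk.rep_eq)

lemma hol_fun_scaleR: "z \<in> unit_disk \<Longrightarrow> hol_fun (c *\<^sub>R f) z = of_real c * hol_fun f z"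
  by (simp add: scaleR_hol_disk.rep_eq)

lemma hol_fun_sum: "z \<in> unit_disk \<Longrightarrow> hol_fun (\<Sum>i\<in>I. f i) z = (\<Sum>i\<in>I. hol_fun (f i) z)"
  by (induction I rule: infinite_finite_induct) (simp_all add: hol_fun_add zero_hol_disk.rep_eq)

lemma mem_closed_hol_disk_if_approximable:
  assumes "closed V"
    and approx: "\<And>C e. compact C \<Longrightarrow> C \<subseteq> unit_disk \<Longrightarrow> e > 0 \<Longrightarrow>
      \<exists>g\<in>V. \<forall>z\<in>C. cmod (hol_fun g z - hol_fun f z) < e"
  shows "f \<in> V"
proof (rule ccontr)
  assume "f \<notin> V"
  have "open (- V)" using \<open>closed V\<close> by (simp add: closed_def)
  with \<open>f \<notin> V\<close> obtain C e where "compact C" "C \<subseteq> unit_disk" "e > 0"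
    and out: "\<forall>g. (\<forall>z\<in>C. cmod (hol_fun g z - hol_fun f z) < e) \<longrightarrow> g \<in> - V"
    unfolding open_hol_disk_def by (meson ComplI)
  with approx[of C e] show False by blast
qed

text \<open>
  The topology has countable neighbourhood bases, given by the exhausting disks of radius
  \<open>1 - 1/(n+1)\<close> and the tolerances \<open>1/(n+1)\<close>.  So an adherent point is the limit of a sequence, and
  this limit is in particular pointwise.
\<close>

lemma closed_hol_disk_if_closed_pointwise:
  assumes lim: "\<And>g f. (\<And>n. g n \<in> V) \<Longrightarrow>
    (\<And>z. z \<in> unit_disk \<Longrightarrow> (\<lambda>n. hol_fun (g n) z) \<longlonglongrightarrow> hol_fun f z) \<Longrightarrow> f \<in> V"
  shows "closed V"
  unfolding closed_def open_hol_disk_def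
proof (rule ballI, rule ccontr)
  fix f assume "f \<in> - V"
  define C where "C n = (cball 0 (1 - inverse (real (Suc n))) :: complex set)" for n
  assume *: "\<not> (\<exists>K e. compact K \<and> K \<subseteq> unit_disk \<and> e > 0 \<and>
     (\<forall>g. (\<forall>z\<in>K. cmod (hol_fun g z - hol_fun f z) < e) \<longrightarrow> g \<in> - V))"
  have "\<exists>g. g \<in> V \<and> (\<forall>z\<in>C n. cmod (hol_fun g z - hol_fun f z) < inverse (real (Suc n)))" for n
  proof -
    have pos: "inverse (real (Suc n)) > 0" by simp
    have "C n \<subseteq> unit_disk"
    proof
      fix x assume "x \<in> C n"
      then show "x \<in> unit_disk" unfolding C_def mem_cball mem_ball dist_0_norm using pos by linarith
    qed
    moreover have "compact (C n)" by (simp add: C_def)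
    moreover note pos
    ultimately show ?thesis using * by blast
  qed
  then obtain g where g: "\<And>n. g n \<in> V"
    "\<And>n z. z \<in> C n \<Longrightarrow> cmod (hol_fun (g n) z - hol_fun f z) < inverse (real (Suc n))" by metis
  have "f \<in> V"
  proof (rule lim[OF g(1)])
    fix z :: complex assume z: "z \<in> unit_disk"
    have "eventually (\<lambda>n. inverse (real (Suc n)) < 1 - norm z) sequentially"
      using order_tendstoD(2)[OF LIMSEQ_inverse_real_of_nat] z by simp
    then have "eventually (\<lambda>n. norm (hol_fun (g n) z - hol_fun f z) \<le> inverse (real (Suc n))) sequentially"
      by eventually_elim (rule less_imp_le[OF g(2)], simp add: C_def)
    from Lim_null_comparison[OF this LIMSEQ_inverse_real_of_nat]
    show "(\<lambda>n. hol_fun (g n) z) \<longlonglongrightarrow> hol_fun f z" by (simp add: LIM_zero_iff)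
  qed
  with \<open>f \<in> - V\<close> show False by simp
qed

text \<open>
  On \<open>T \<times> C\<close>, with \<open>C\<close> compact in the disk, the kernel is uniformly continuous.  Cutting \<open>T\<close> into
  finitely many small Borel pieces and freezing the parameter at one point of each piece therefore
  changes the average by little, uniformly on \<open>C\<close>; and the frozen average is a finite convex
  combination of elements of \<open>V\<close>.
\<close>

lemma average_mem_closed_convex:
  fixes K :: "'t::metric_space \<Rightarrow> hol_disk"
  assumes V: "closed V" "convex V" and T: "compact T" and KV: "\<And>t. t \<in> T \<Longrightarrow> K t \<in> V"
    and cont: "continuous_on (T \<times> unit_disk) (\<lambda>(t, z). hol_fun (K t) z)"
    and M: "prob_space M" and \<xi>: "\<xi> \<in> borel_measurable M" and \<xi>T: "\<And>\<omega>. \<omega> \<in> space M \<Longrightarrow> \<xi> \<omega> \<in> T"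
    and f: "\<And>z. z \<in> unit_disk \<Longrightarrow> hol_fun f z = (\<integral>\<omega>. hol_fun (K (\<xi> \<omega>)) z \<partial>M)"
  shows "f \<in> V"
proof (rule mem_closed_hol_disk_if_approximable[OF V(1)])
  interpret prob_space M by fact
  fix C :: "complex set" and e :: real
  assume C: "compact C" "C \<subseteq> unit_disk" and e: "e > 0"
  have "uniformly_continuous_on (T \<times> C) (\<lambda>(t, z). hol_fun (K t) z)"
    by (intro compact_uniformly_continuous compact_Times T C continuous_on_subset[OF cont])
       (use C in auto)
  then obtain d where d: "d > 0" and unif: "\<forall>p\<in>T \<times> C. \<forall>p'\<in>T \<times> C. dist p' p < d \<longrightarrow>
      dist (case p' of (t, z) \<Rightarrow> hol_fun (K t) z) (case p of (t, z) \<Rightarrow> hol_fun (K t) z) < e / 2"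
    using e unfolding uniformly_continuous_on_def by (metis half_gt_zero)
  have near: "norm (hol_fun (K s) z - hol_fun (K t) z) < e / 2"
    if "s \<in> T" "t \<in> T" "z \<in> C" "dist s t < d" for s t z
    using bspec[OF bspec[OF unif, of "(t, z)"], of "(s, z)"] that
    by (simp add: dist_norm dist_Pair_Pair)
  obtain k where k: "finite k" "k \<subseteq> T" "T \<subseteq> (\<Union>x\<in>k. ball x d)"
    using seq_compact_imp_totally_bounded[OF compact_imp_seq_compact[OF T], rule_format, OF d]
    by (elim exE conjE)
  obtain c where c: "bij_betw c {0..<card k} k" using ex_bij_betw_nat_finite[OF k(1)] by blast
  define n where "n = card k"
  define D where "D = disjointed (\<lambda>i. ball (c i) d)"
  define S where "S i = \<xi> -` D i \<inter> space M" for i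
  have ck: "c ` {0..<n} = k" using c by (simp add: n_def bij_betw_def)
  have cT: "c i \<in> T" if "i < n" for i using ck that k(2) by auto
  have "D i \<in> sets borel" for i
  proof -
    have "range (\<lambda>i. ball (c i) d) \<subseteq> sets borel" by auto
    from sets.range_disjointed_sets[OF this] show ?thesis by (auto simp: D_def)
  qed
  then have S: "S i \<in> sets M" for i unfolding S_def by (intro measurable_sets[OF \<xi>])
  have disj: "disjoint_family_on S {..<n}"
    unfolding disjoint_family_on_def
  proof (intro ballI impI)
    fix i j assume "i \<noteq> (j::nat)"
    then have "D i \<inter> D j = {}"
      unfolding D_def by (rule disjoint_family_onD[OF disjoint_family_disjointed UNIV_I UNIV_I])
    then show "S i \<inter> S j = {}" by (auto simp: S_def)
  qed
  have cover: "\<exists>i<n. \<omega> \<in> S i" if \<omega>: "\<omega> \<in> space M" for \<omega>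
  proof -
    have "\<xi> \<omega> \<in> (\<Union>i\<in>{0..<n}. ball (c i) d)"
      using subsetD[OF k(3) \<xi>T[OF \<omega>]] unfolding ck[symmetric] by simp
    then have "\<xi> \<omega> \<in> (\<Union>i\<in>{0..<n}. D i)" unfolding D_def by (simp add: finite_UN_disjointed_eq)
    then show ?thesis using \<omega> by (auto simp: S_def)
  qed
  define g where "g = (\<Sum>i<n. prob (S i) *\<^sub>R K (c i))"
  have "(\<Sum>i<n. prob (S i)) = prob (\<Union>i<n. S i)"
    using S disj by (intro finite_measure_finite_Union[symmetric]) auto
  also have "(\<Union>i<n. S i) = space M"
  proof
    show "(\<Union>i<n. S i) \<subseteq> space M" by (auto simp: S_def)
    show "space M \<subseteq> (\<Union>i<n. S i)"
    proof
      fix \<omega> assume "\<omega> \<in> space M"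
      from cover[OF this] obtain i where "i < n" "\<omega> \<in> S i" by (elim exE conjE)
      then show "\<omega> \<in> (\<Union>i<n. S i)" by (intro UN_I[of i]) simp_all
    qed
  qed
  finally have "(\<Sum>i<n. prob (S i)) = 1" by (simp add: prob_space)
  then have gV: "g \<in> V" unfolding g_def
    by (intro convex_sum V(2)) (auto intro: KV cT)
  have "cmod (hol_fun g z - hol_fun f z) < e" if z: "z \<in> C" for z
  proof -
    have zd: "z \<in> unit_disk" using z C(2) by auto
    define F where "F = (\<lambda>\<omega>. hol_fun (K (\<xi> \<omega>)) z)"
    define s where "s = (\<lambda>\<omega>. \<Sum>i<n. indicator (S i) \<omega> *\<^sub>R hol_fun (K (c i)) z)"
    have cK: "continuous_on T (\<lambda>t. hol_fun (K t) z)"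
    proof -
      have "continuous_on T (\<lambda>t. (t, z))" by (intro continuous_intros)
      moreover have "(\<lambda>t. (t, z)) ` T \<subseteq> T \<times> unit_disk" using zd by auto
      ultimately show ?thesis using continuous_on_compose2[OF cont] by fastforce
    qed
    have "\<xi> \<in> measurable M (restrict_space borel T)"
      using \<xi> \<xi>T by (intro measurable_restrict_space2) auto
    from measurable_compose[OF this borel_measurable_continuous_on_restrict[OF cK]]
    have "F \<in> borel_measurable M" by (simp add: F_def)
    have "bounded ((\<lambda>t. hol_fun (K t) z) ` T)"
      using cK T by (intro compact_imp_bounded compact_continuous_image) auto
    then obtain B where "\<forall>t\<in>T. norm (hol_fun (K t) z) \<le> B" unfolding bounded_iff ball_simps by blast
    with \<xi>T have "integrable M F"
      by (intro integrable_const_bound[of _ B] \<open>F \<in> borel_measurable M\<close>) (auto simp: F_def)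
    have "integrable M s" unfolding s_def
      by (intro Bochner_Integration.integrable_sum integrable_scaleR_left integrable_real_indicator)
         (use S in \<open>auto simp: emeasure_eq_measure\<close>)
    have S_int: "(\<integral>\<omega>. indicator (S i) \<omega> *\<^sub>R v \<partial>M) = prob (S i) *\<^sub>R v" for i and v :: complex
    proof -
      have "integrable M (indicator (S i) :: _ \<Rightarrow> real)"
        using S by (simp add: emeasure_eq_measure)
      then have "(\<integral>\<omega>. indicator (S i) \<omega> *\<^sub>R v \<partial>M) = (\<integral>\<omega>. indicator (S i) \<omega> \<partial>M) *\<^sub>R v"
        by (intro integral_scaleR_left)
      also have "(\<integral>\<omega>. indicator (S i) \<omega> \<partial>M) = prob (S i)"
        using sets.Int_space_eq2[OF S[of i]] by simp
      finally show ?thesis .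
    qed
    have "(\<integral>\<omega>. s \<omega> \<partial>M) = (\<Sum>i<n. \<integral>\<omega>. indicator (S i) \<omega> *\<^sub>R hol_fun (K (c i)) z \<partial>M)"
      unfolding s_def using S
      by (intro Bochner_Integration.integral_sum integrable_scaleR_left integrable_real_indicator)
         (auto simp: emeasure_eq_measure)
    also have "\<dots> = (\<Sum>i<n. prob (S i) *\<^sub>R hol_fun (K (c i)) z)"
      by (intro sum.cong refl S_int)
    also have "\<dots> = hol_fun g z"
      by (simp add: g_def hol_fun_sum[OF zd] hol_fun_scaleR[OF zd] scaleR_conv_of_real)
    finally have "hol_fun g z - hol_fun f z = (\<integral>\<omega>. s \<omega> - F \<omega> \<partial>M)"
      using f[OF zd] \<open>integrable M s\<close> \<open>integrable M F\<close> by (simp add: F_def)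
    then have "norm (hol_fun g z - hol_fun f z) \<le> (\<integral>\<omega>. norm (s \<omega> - F \<omega>) \<partial>M)"
      by simp
    also have "\<dots> \<le> e / 2"
    proof (rule integral_le_const)
      show "integrable M (\<lambda>\<omega>. norm (s \<omega> - F \<omega>))"
        using \<open>integrable M s\<close> \<open>integrable M F\<close> by simp
      show "AE \<omega> in M. norm (s \<omega> - F \<omega>) \<le> e / 2"
      proof (rule AE_I2)
        fix \<omega> assume \<omega>: "\<omega> \<in> space M"
        obtain i where i: "i < n" "\<omega> \<in> S i" using cover[OF \<omega>] by blast
        have "indicator (S j) \<omega> = (if j = i then 1 else (0::real))" if "j < n" for j
          using disj i that by (auto simp: disjoint_family_on_def indicator_def)
        then have "s \<omega> = (\<Sum>j<n. (if j = i then 1 else 0) *\<^sub>R hol_fun (K (c j)) z)"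
          unfolding s_def by (intro sum.cong) auto
        also have "\<dots> = hol_fun (K (c i)) z"
          using i(1) by (simp add: if_distrib[of "\<lambda>x. x *\<^sub>R _"] cong: if_cong)
        finally have "s \<omega> = hol_fun (K (c i)) z" .
        moreover have "\<xi> \<omega> \<in> ball (c i) d"
          using i(2) disjointed_subset[of "\<lambda>i. ball (c i) d" i] by (auto simp: S_def D_def)
        ultimately show "norm (s \<omega> - F \<omega>) \<le> e / 2"
          using near[OF cT[OF i(1)] \<xi>T[OF \<omega>] z] by (simp add: F_def)
      qed
    qed
    also have "\<dots> < e" using e by simp
    finally show ?thesis .
  qed
  with gV show "\<exists>g\<in>V. \<forall>z\<in>C. cmod (hol_fun g z - hol_fun f z) < e" by blast
qed

section \<open>Means of Koebe functions\<close>

abbreviation koebe :: "complex \<Rightarrow> hol_disk" where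
  "koebe x \<equiv> disk_restrict (\<lambda>z. z / (1 - x * z)\<^sup>2)"

definition koebe_means :: "hol_disk set" where
  "koebe_means = {f. \<exists>\<mu>\<in>circle_prob_measures.
     \<forall>z\<in>unit_disk. hol_fun f z = (\<integral>x. z / (1 - x * z)\<^sup>2 \<partial>\<mu>)}"

lemma koebe_means_measureI:
  assumes "\<mu> \<in> circle_prob_measures"
    and "\<And>z. z \<in> unit_disk \<Longrightarrow> hol_fun f z = (\<integral>x. z / (1 - x * z)\<^sup>2 \<partial>\<mu>)"
  shows "f \<in> koebe_means"
  unfolding koebe_means_def using assms by (intro CollectI bexI[of _ \<mu>] ballI)

lemma koebe_meansE:
  assumes "f \<in> koebe_means"
  obtains \<mu> where "\<mu> \<in> circle_prob_measures"
    "\<forall>z\<in>unit_disk. hol_fun f z = (\<integral>x. z / (1 - x * z)\<^sup>2 \<partial>\<mu>)"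
  using assms unfolding koebe_means_def mem_Collect_eq by (elim bexE)

lemma average_of_restrictions_mem_closed_convex:
  fixes k :: "'t::metric_space \<Rightarrow> complex \<Rightarrow> complex"
  assumes V: "closed V" "convex V" and T: "compact T"
    and cont: "continuous_on (T \<times> unit_disk) (\<lambda>p. k (fst p) (snd p))"
    and hol: "\<And>t. t \<in> T \<Longrightarrow> k t holomorphic_on unit_disk"
    and KV: "\<And>t. t \<in> T \<Longrightarrow> disk_restrict (k t) \<in> V"
    and M: "prob_space M" and \<xi>: "\<xi> \<in> borel_measurable M" and \<xi>T: "\<And>\<omega>. \<omega> \<in> space M \<Longrightarrow> \<xi> \<omega> \<in> T"
    and h: "h holomorphic_on unit_disk" "\<And>z. z \<in> unit_disk \<Longrightarrow> h z = (\<integral>\<omega>. k (\<xi> \<omega>) z \<partial>M)"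
  shows "disk_restrict h \<in> V"
proof (rule average_mem_closed_convex[OF V T KV _ M \<xi> \<xi>T])
  have eq: "k (fst p) (snd p) = (case p of (t, z) \<Rightarrow> hol_fun (disk_restrict (k t)) z)"
    if "p \<in> T \<times> unit_disk" for p
    using that hol_fun_disk_restrict[OF hol, of "fst p" "snd p"] by (auto simp: mem_Times_iff split_beta)
  show "continuous_on (T \<times> unit_disk) (\<lambda>(t, z). hol_fun (disk_restrict (k t)) z)"
    by (rule continuous_on_eq[OF cont eq])
  fix z assume z: "z \<in> unit_disk"
  have "(\<integral>\<omega>. hol_fun (disk_restrict (k (\<xi> \<omega>))) z \<partial>M) = (\<integral>\<omega>. k (\<xi> \<omega>) z \<partial>M)"
    by (intro Bochner_Integration.integral_cong refl hol_fun_disk_restrict[OF hol[OF \<xi>T] z])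
  then show "hol_fun (disk_restrict h) z = (\<integral>\<omega>. hol_fun (disk_restrict (k (\<xi> \<omega>))) z \<partial>M)"
    using h z by (simp add: hol_fun_disk_restrict)
qed

lemma holomorphic_koebe: "norm x \<le> 1 \<Longrightarrow> (\<lambda>z. z / (1 - x * z)\<^sup>2) holomorphic_on unit_disk"
  by (intro holomorphic_intros) (use one_minus_mult_nonzero in auto)

lemma hol_fun_koebe: "norm x \<le> 1 \<Longrightarrow> norm z < 1 \<Longrightarrow> hol_fun (koebe x) z = z / (1 - x * z)\<^sup>2"
  using hol_fun_disk_restrict[OF holomorphic_koebe] by simp

lemma koebe_meansI:
  assumes "prob_space M" "\<xi> \<in> borel_measurable M" "\<And>\<omega>. \<omega> \<in> space M \<Longrightarrow> norm (\<xi> \<omega>) = 1"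
    and f: "\<And>z. norm z < 1 \<Longrightarrow> hol_fun f z = (\<integral>\<omega>. z / (1 - \<xi> \<omega> * z)\<^sup>2 \<partial>M)"
  shows "f \<in> koebe_means"
proof -
  note d = distr_circle_prob_measures[OF assms(1-3)]
  have "hol_fun f z = (\<integral>x. z / (1 - x * z)\<^sup>2 \<partial>distr M (restrict_space borel circle) \<xi>)"
    if "z \<in> unit_disk" for z
    using that f[of z] d(2)[OF _ continuous_on_koebe_kernel[of z circle]] by auto
  with d(1) show ?thesis by (rule koebe_means_measureI)
qed

text \<open>
  On the circle the representing measure is a point mass.  Inside the disk it is the Poisson measure
  of \<open>w\<close>, because \<open>w \<mapsto> z / (1 - w z)\<^sup>2\<close> is analytic on the closed disk for every fixed \<open>z\<close>.
\<close>

lemma koebe_mem_koebe_means: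
  assumes "norm w \<le> 1"
  shows "koebe w \<in> koebe_means"
proof (cases "norm w = 1")
  case True
  interpret prob_space arc_measure using arc_measure_circle by (simp add: circle_prob_measures_def)
  show ?thesis
    \<comment> \<open>a point mass, realised as the law of a constant random variable\<close>
    by (rule koebe_meansI[OF prob_space_axioms, of "\<lambda>_. w"])
       (simp_all add: hol_fun_koebe assms True prob_space)
next
  case False
  with assms have w: "norm w < 1" by simp
  obtain \<nu> where \<nu>: "\<nu> \<in> circle_prob_measures"
    "\<And>H. H holomorphic_on cball 0 1 \<Longrightarrow> H w = (\<integral>x. H x \<partial>\<nu>)"
    using Poisson_on_closed_disk[OF w] by blast
  have "hol_fun (koebe w) z = (\<integral>x. z / (1 - x * z)\<^sup>2 \<partial>\<nu>)" if "z \<in> unit_disk" for z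
  proof -
    have z: "norm z < 1" using that by simp
    have "(\<lambda>x. z / (1 - x * z)\<^sup>2) holomorphic_on cball 0 1"
      by (intro holomorphic_intros) (use one_minus_mult_nonzero[OF z] in auto)
    from \<nu>(2)[OF this] show ?thesis using hol_fun_koebe[OF assms z] by simp
  qed
  with \<nu>(1) show ?thesis by (rule koebe_means_measureI)
qed

text \<open>
  A subsequence of representing measures converges weakly, and for fixed \<open>z\<close> the kernel
  is a continuous function of \<open>x\<close>; so the weak limit represents \<open>f\<close>.
\<close>

lemma koebe_means_pointwise_limit:
  assumes g: "\<And>n. g n \<in> koebe_means"
    and lim: "\<And>z. norm z < 1 \<Longrightarrow> (\<lambda>n. hol_fun (g n) z) \<longlonglongrightarrow> hol_fun f z"
  shows "f \<in> koebe_means"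
proof -
  define \<mu> where "\<mu> n = (SOME \<mu>. \<mu> \<in> circle_prob_measures \<and>
      (\<forall>z\<in>unit_disk. hol_fun (g n) z = (\<integral>x. z / (1 - x * z)\<^sup>2 \<partial>\<mu>)))" for n
  have "\<mu> n \<in> circle_prob_measures \<and>
      (\<forall>z\<in>unit_disk. hol_fun (g n) z = (\<integral>x. z / (1 - x * z)\<^sup>2 \<partial>\<mu> n))" for n
    unfolding \<mu>_def by (rule someI_ex) (use g[of n] in \<open>simp add: koebe_means_def Bex_def\<close>)
  then have \<mu>: "\<And>n. \<mu> n \<in> circle_prob_measures"
    "\<And>n z. z \<in> unit_disk \<Longrightarrow> hol_fun (g n) z = (\<integral>x. z / (1 - x * z)\<^sup>2 \<partial>\<mu> n)"
    by simp_all
  obtain r \<nu> where r: "strict_mono (r :: nat \<Rightarrow> nat)" and \<nu>: "\<nu> \<in> circle_prob_measures"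
    and conv: "\<And>f :: complex \<Rightarrow> complex. continuous_on circle f \<Longrightarrow>
      (\<lambda>n. \<integral>x. f x \<partial>\<mu> (r n)) \<longlonglongrightarrow> (\<integral>x. f x \<partial>\<nu>)"
    using circle_prob_measures_weakly_compact[of \<mu>, OF \<mu>(1)] by blast
  have "hol_fun f z = (\<integral>x. z / (1 - x * z)\<^sup>2 \<partial>\<nu>)" if z: "z \<in> unit_disk" for z
  proof (rule LIMSEQ_unique)
    show "(\<lambda>n. hol_fun (g (r n)) z) \<longlonglongrightarrow> hol_fun f z"
      using LIMSEQ_subseq_LIMSEQ[OF lim r] z by (simp add: o_def)
    show "(\<lambda>n. hol_fun (g (r n)) z) \<longlonglongrightarrow> (\<integral>x. z / (1 - x * z)\<^sup>2 \<partial>\<nu>)"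
      unfolding \<mu>(2)[OF z] by (rule conv[OF continuous_on_koebe_kernel]) (use z in auto)
  qed
  with \<nu> show ?thesis by (rule koebe_means_measureI)
qed

lemma closed_koebe_means: "closed koebe_means"
  by (rule closed_hol_disk_if_closed_pointwise, rule koebe_means_pointwise_limit) simp_all

lemma convex_koebe_means: "convex koebe_means"
proof (rule convexI)
  fix f g and u v :: real
  assume f: "f \<in> koebe_means" and g: "g \<in> koebe_means" and uv: "0 \<le> u" "0 \<le> v" "u + v = 1"
  obtain \<mu> where \<mu>: "\<mu> \<in> circle_prob_measures"
    "\<forall>z\<in>unit_disk. hol_fun f z = (\<integral>x. z / (1 - x * z)\<^sup>2 \<partial>\<mu>)"
    by (rule koebe_meansE[OF f])
  obtain \<nu> where \<nu>: "\<nu> \<in> circle_prob_measures"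
    "\<forall>z\<in>unit_disk. hol_fun g z = (\<integral>x. z / (1 - x * z)\<^sup>2 \<partial>\<nu>)"
    by (rule koebe_meansE[OF g])
  have v: "v = 1 - u" and u1: "u \<le> 1" using uv by auto
  obtain \<rho> where \<rho>: "\<rho> \<in> circle_prob_measures"
    "\<And>f :: complex \<Rightarrow> complex. continuous_on circle f \<Longrightarrow>
      (\<integral>x. f x \<partial>\<rho>) = of_real u * (\<integral>x. f x \<partial>\<mu>) + of_real (1 - u) * (\<integral>x. f x \<partial>\<nu>)"
    using circle_prob_measure_mixture[OF \<mu>(1) \<nu>(1) uv(1) u1] by blast
  have "hol_fun (u *\<^sub>R f + v *\<^sub>R g) z = (\<integral>x. z / (1 - x * z)\<^sup>2 \<partial>\<rho>)" if z: "z \<in> unit_disk" for z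
    using z \<mu>(2) \<nu>(2) \<rho>(2)[OF continuous_on_koebe_kernel[of z circle]]
    by (simp add: hol_fun_add hol_fun_scaleR v)
  with \<rho>(1) show "u *\<^sub>R f + v *\<^sub>R g \<in> koebe_means" by (rule koebe_means_measureI)
qed

lemma hol_fun_image_koebe_means:
  "hol_fun ` koebe_means =
     {\<lambda>z\<in>unit_disk. \<integral>x. z / (1 - x * z)\<^sup>2 \<partial>\<mu> | \<mu>. \<mu> \<in> circle_prob_measures}" (is "?L = ?R")
proof
  show "?L \<subseteq> ?R"
  proof (rule image_subsetI)
    fix f assume "f \<in> koebe_means"
    then obtain \<mu> where \<mu>: "\<mu> \<in> circle_prob_measures"
      "\<forall>z\<in>unit_disk. hol_fun f z = (\<integral>x. z / (1 - x * z)\<^sup>2 \<partial>\<mu>)"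
      by (rule koebe_meansE)
    from \<mu>(1) show "hol_fun f \<in> ?R"
      by (intro CollectI exI[of _ \<mu>] conjI hol_fun_eq_restrictI \<mu>(2)[rule_format])
  qed
  show "?R \<subseteq> ?L"
  proof clarify
    fix \<mu> assume \<mu>: "\<mu> \<in> circle_prob_measures"
    let ?f = "disk_restrict (\<lambda>z. \<integral>x. z / (1 - x * z)\<^sup>2 \<partial>\<mu>)"
    have eq: "hol_fun ?f z = (\<integral>x. z / (1 - x * z)\<^sup>2 \<partial>\<mu>)" if "z \<in> unit_disk" for z
      by (rule hol_fun_disk_restrict[OF holomorphic_koebe_mean[OF \<mu>] that])
    with \<mu> have "?f \<in> koebe_means" by (rule koebe_means_measureI)
    moreover have "(\<lambda>z\<in>unit_disk. \<integral>x. z / (1 - x * z)\<^sup>2 \<partial>\<mu>) = hol_fun ?f"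
      by (rule hol_fun_eq_restrictI[OF eq, symmetric])
    ultimately show "(\<lambda>z\<in>unit_disk. \<integral>x. z / (1 - x * z)\<^sup>2 \<partial>\<mu>) \<in> ?L" by (rule rev_image_eqI)
  qed
qed

lemma koebe_means_subset_closed_convex:
  assumes V: "closed V" "convex V" and KV: "\<And>x. norm x = 1 \<Longrightarrow> koebe x \<in> V"
  shows "koebe_means \<subseteq> V"
proof
  fix f assume "f \<in> koebe_means"
  then obtain \<mu> where \<mu>: "\<mu> \<in> circle_prob_measures"
    and f: "\<forall>z\<in>unit_disk. hol_fun f z = (\<integral>x. z / (1 - x * z)\<^sup>2 \<partial>\<mu>)"
    by (rule koebe_meansE)
  let ?h = "\<lambda>z. \<integral>x. z / (1 - x * z)\<^sup>2 \<partial>\<mu>"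
  have "disk_restrict ?h \<in> V"
  proof (rule average_of_restrictions_mem_closed_convex[OF V, where T = circle and M = \<mu> and \<xi> = "\<lambda>x. x"])
    show "continuous_on (circle \<times> unit_disk) (\<lambda>p. snd p / (1 - fst p * snd p)\<^sup>2)"
      by (intro continuous_intros) (use one_minus_mult_nonzero in auto)
    show "prob_space \<mu>" using \<mu> by (simp add: circle_prob_measures_def)
    show "(\<lambda>x. x) \<in> borel_measurable \<mu>" by (intro borel_measurable_circle_measure \<mu> continuous_intros)
    show "?h holomorphic_on unit_disk" by (rule holomorphic_koebe_mean[OF \<mu>])
  qed (simp_all add: holomorphic_koebe KV space_circle_measure[OF \<mu>])
  moreover have "f = disk_restrict ?h"
    using f hol_fun_disk_restrict[OF holomorphic_koebe_mean[OF \<mu>]] by (intro hol_disk_eqI) simp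
  ultimately show "f \<in> V" by simp
qed

section \<open>Functions in the class are means of Koebe functions\<close>

text \<open>
  This form of the antiderivative has no \<open>b\<close> in a denominator, so the degenerate case \<open>x = y\<close> of the
  next lemma needs no separate treatment.
\<close>

lemma inverse_square_antiderivative:
  fixes a b u :: complex
  assumes "a \<noteq> 0" "a - u * b \<noteq> 0"
  shows "((\<lambda>u. u / (a * (a - u * b))) has_field_derivative 1 / (a - u * b)\<^sup>2) (at u)"
proof -
  have nz: "a * (a - u * b) \<noteq> 0" using assms by simp
  have "((\<lambda>u. a * (a - u * b)) has_field_derivative - (a * b)) (at u)"
    by (auto intro!: derivative_eq_intros)
  then have "((\<lambda>u. u / (a * (a - u * b))) has_field_derivative
      (1 * (a * (a - u * b)) - u * (- (a * b))) / (a * (a - u * b) * (a * (a - u * b)))) (at u)"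
    using nz by (rule DERIV_divide[OF DERIV_ident])
  also have "1 * (a * (a - u * b)) - u * (- (a * b)) = a * a" by (simp add: algebra_simps)
  also have "a * a / (a * (a - u * b) * (a * (a - u * b))) = 1 / (a - u * b)\<^sup>2"
    using assms by (simp add: power2_eq_square)
  finally show ?thesis .
qed

text \<open>
  Along the segment from \<open>y\<close> to \<open>x\<close> the squared kernel integrates to
  \<open>\<integral>\<^sub>0\<^sup>1 1 / (1 - (t x + (1 - t) y) z)\<^sup>2 dt = 1 / ((1 - x z) (1 - y z))\<close>, so the product is an average of
  Koebe functions with parameters in the closed disk.
\<close>

lemma product_of_Cauchy_kernels_mem_koebe_means:
  assumes x: "norm x \<le> 1" and y: "norm y \<le> 1"
  shows "disk_restrict (\<lambda>z. z / ((1 - x * z) * (1 - y * z))) \<in> koebe_means"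
proof -
  let ?w = "\<lambda>t. of_real t * x + of_real (1 - t) * y"
  have w: "norm (?w t) \<le> 1" if "t \<in> {0..1}" for t :: real
  proof -
    have "norm (?w t) \<le> t * norm x + (1 - t) * norm y"
      using norm_triangle_ineq[of "of_real t * x" "of_real (1 - t) * y"] that
      by (simp add: norm_mult del: of_real_diff)
    also have "\<dots> \<le> 1" using that x y by (intro convex_bound_le) auto
    finally show ?thesis .
  qed
  have nz: "1 - ?w t * z \<noteq> 0" if "t \<in> {0..1}" "norm z < 1" for t z
    using one_minus_mult_nonzero[OF that(2) w[OF that(1)]] .
  show ?thesis
  proof (rule average_of_restrictions_mem_closed_convex[OF closed_koebe_means convex_koebe_means,
        where T = "{0..1::real}" and M = "restrict_space lborel {0..1}" and \<xi> = "\<lambda>t. t"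
          and k = "\<lambda>t z. z / (1 - ?w t * z)\<^sup>2"])
    show "continuous_on ({0..1} \<times> unit_disk) (\<lambda>p. snd p / (1 - ?w (fst p) * snd p)\<^sup>2)"
      by (intro continuous_intros) (use nz in auto)
    show "(\<lambda>z. z / (1 - ?w t * z)\<^sup>2) holomorphic_on unit_disk" if "t \<in> {0..1}" for t
      by (rule holomorphic_koebe[OF w[OF that]])
    show "koebe (?w t) \<in> koebe_means" if "t \<in> {0..1}" for t
      by (rule koebe_mem_koebe_means[OF w[OF that]])
    show "prob_space (restrict_space lborel {0..1::real})" by (rule prob_space_unit_interval)
    show "(\<lambda>t. t) \<in> borel_measurable (restrict_space lborel {0..1::real})"
      by (rule measurable_restrict_space1) simp
    show "(\<lambda>z. z / ((1 - x * z) * (1 - y * z))) holomorphic_on unit_disk"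
      by (intro holomorphic_intros) (use one_minus_mult_nonzero x y in auto)
    fix z assume "z \<in> unit_disk"
    then have z: "norm z < 1" by simp
    define A where "A = 1 - y * z"
    define B where "B = (x - y) * z"
    have AB: "1 - ?w t * z = A - of_real t * B" for t by (simp add: A_def B_def algebra_simps)
    have A: "A \<noteq> 0" unfolding A_def by (rule one_minus_mult_nonzero[OF z y])
    have "((\<lambda>t. 1 / (1 - ?w t * z)\<^sup>2) has_integral
        (of_real 1 / (A * (A - of_real 1 * B)) - of_real 0 / (A * (A - of_real 0 * B)))) {0..1}"
    proof (rule fundamental_theorem_of_calculus)
      fix t :: real assume t: "t \<in> {0..1}"
      have "((\<lambda>u. u / (A * (A - u * B))) has_field_derivative 1 / (A - of_real t * B)\<^sup>2)
          (at (of_real t))"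
        using nz[OF t z] unfolding AB by (rule inverse_square_antiderivative[OF A])
      then show "((\<lambda>t. of_real t / (A * (A - of_real t * B))) has_vector_derivative
          1 / (1 - ?w t * z)\<^sup>2) (at t within {0..1})"
        unfolding AB by (rule has_vector_derivative_real_field)
    qed simp
    moreover have "A - of_real 1 * B = 1 - x * z" by (simp add: A_def B_def algebra_simps)
    then have "of_real 1 / (A * (A - of_real 1 * B)) - of_real 0 / (A * (A - of_real 0 * B))
        = 1 / ((1 - x * z) * (1 - y * z))" by (simp add: A_def mult.commute)
    ultimately have "((\<lambda>t. 1 / (1 - ?w t * z)\<^sup>2) has_integral 1 / ((1 - x * z) * (1 - y * z))) {0..1}"
      by (simp only:)
    from has_integral_mult_right[OF this, of z]
    have "((\<lambda>t. z / (1 - ?w t * z)\<^sup>2) has_integral z / ((1 - x * z) * (1 - y * z))) {0..1}"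
      by (simp only: times_divide_eq_right mult_1_right)
    moreover have "((\<lambda>t. z / (1 - ?w t * z)\<^sup>2) has_integral
        (\<integral>t. z / (1 - ?w t * z)\<^sup>2 \<partial>restrict_space lborel {0..1})) {0..1}"
      by (intro integral_unit_interval continuous_intros) (use nz z in auto)
    ultimately show "z / ((1 - x * z) * (1 - y * z)) =
        (\<integral>t. z / (1 - ?w t * z)\<^sup>2 \<partial>restrict_space lborel {0..1})"
      by (rule has_integral_unique)
  qed (auto simp: space_restrict_space)
qed

text \<open>
  Replacing the two factors \<open>g z\<close> by their Herglotz integrals one after the other leaves averages of
  products of two Cauchy kernels.  Averaging in two stages avoids integration over a product space:
  each stage stays in the closed convex set of means.
\<close>

lemma square_mem_koebe_means:
  assumes hol: "g holomorphic_on cball 0 1" and g0: "g 0 = 1" and pos: "\<And>x. norm x = 1 \<Longrightarrow> Re (g x) \<ge> 1/2"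
  shows "disk_restrict (\<lambda>z. z * (g z)\<^sup>2) \<in> koebe_means"
proof -
  obtain \<nu> where \<nu>: "\<nu> \<in> circle_prob_measures"
    and g_all: "\<forall>z. norm z < 1 \<longrightarrow> g z = (\<integral>x. 1 / (1 - cnj x * z) \<partial>\<nu>)"
    by (rule Herglotz_on_closed_disk[OF hol g0 pos])
  note g = g_all[rule_format]
  have hg: "g holomorphic_on unit_disk" by (rule holomorphic_on_subset[OF hol]) auto
  have cg: "continuous_on unit_disk g" by (rule holomorphic_on_imp_continuous_on[OF hg])
  have cg': "continuous_on (circle \<times> unit_disk) (\<lambda>p. g (snd p))"
    by (rule continuous_on_compose2[OF cg]) (auto intro!: continuous_intros)
  have nz: "1 - x * z \<noteq> 0" if "norm x = 1" "norm z < 1" for x z :: complex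
    using one_minus_mult_nonzero[of z x] that by simp
  note avg = average_of_restrictions_mem_closed_convex[OF closed_koebe_means convex_koebe_means,
      where T = circle and M = \<nu> and \<xi> = cnj]
  have \<nu>p: "prob_space \<nu>" using \<nu> by (simp add: circle_prob_measures_def)
  have cnj: "cnj \<in> borel_measurable \<nu>"
    by (intro borel_measurable_circle_measure \<nu> continuous_intros)
  have cnjT: "cnj x \<in> circle" if "x \<in> space \<nu>" for x
    using that by (simp add: space_circle_measure[OF \<nu>])
  have step: "disk_restrict (\<lambda>z. z * g z / (1 - y * z)) \<in> koebe_means" if y: "norm y = 1" for y
  proof (rule avg[where k = "\<lambda>x z. z / ((1 - x * z) * (1 - y * z))"])
    show "continuous_on (circle \<times> unit_disk) (\<lambda>p. snd p / ((1 - fst p * snd p) * (1 - y * snd p)))"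
      by (intro continuous_intros) (use nz y in auto)
    show "(\<lambda>z. z / ((1 - x * z) * (1 - y * z))) holomorphic_on unit_disk" if "x \<in> circle" for x
      by (intro holomorphic_intros) (use nz y that in auto)
    show "disk_restrict (\<lambda>z. z / ((1 - x * z) * (1 - y * z))) \<in> koebe_means" if "x \<in> circle" for x
      using product_of_Cauchy_kernels_mem_koebe_means[of x y] that y by simp
    show "(\<lambda>z. z * g z / (1 - y * z)) holomorphic_on unit_disk"
      by (intro holomorphic_intros hg) (use nz y in auto)
    fix z assume z: "z \<in> unit_disk"
    have "z * g z / (1 - y * z) = z / (1 - y * z) * (\<integral>x. 1 / (1 - cnj x * z) \<partial>\<nu>)"
      using g[of z] z by simp
    also have "\<dots> = (\<integral>x. z / (1 - y * z) * (1 / (1 - cnj x * z)) \<partial>\<nu>)"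
      by (rule integral_mult_right_zero[symmetric])
    also have "\<dots> = (\<integral>x. z / ((1 - cnj x * z) * (1 - y * z)) \<partial>\<nu>)"
      by (simp add: mult.commute)
    finally show "z * g z / (1 - y * z) = \<dots>" .
  qed (use \<nu>p cnj cnjT in auto)
  show ?thesis
  proof (rule avg[where k = "\<lambda>y z. z * g z / (1 - y * z)"])
    show "continuous_on (circle \<times> unit_disk) (\<lambda>p. snd p * g (snd p) / (1 - fst p * snd p))"
      by (intro continuous_intros cg') (use nz in auto)
    show "(\<lambda>z. z * g z / (1 - y * z)) holomorphic_on unit_disk" if "y \<in> circle" for y
      by (intro holomorphic_intros hg) (use nz that in auto)
    show "(\<lambda>z. z * (g z)\<^sup>2) holomorphic_on unit_disk" by (intro holomorphic_intros hg)
    fix z assume z: "z \<in> unit_disk"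
    have "z * (g z)\<^sup>2 = z * g z * (\<integral>x. 1 / (1 - cnj x * z) \<partial>\<nu>)"
      using g[of z] z by (simp add: power2_eq_square)
    also have "\<dots> = (\<integral>x. z * g z * (1 / (1 - cnj x * z)) \<partial>\<nu>)"
      by (rule integral_mult_right_zero[symmetric])
    finally show "z * (g z)\<^sup>2 = (\<integral>y. z * g z / (1 - cnj y * z) \<partial>\<nu>)" by simp
  qed (use \<nu>p cnj cnjT step in auto)
qed

text \<open>
  The dilations \<open>g (R z)\<close> with \<open>R < 1\<close> are analytic on the closed disk; the result follows
  by letting \<open>R\<close> tend to 1.
\<close>

lemma square_mem_koebe_means_open_disk:
  assumes hol: "g holomorphic_on unit_disk" and g0: "g 0 = 1" and pos: "\<And>z. norm z < 1 \<Longrightarrow> Re (g z) > 1/2"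
    and f: "\<And>z. norm z < 1 \<Longrightarrow> hol_fun f z = z * (g z)\<^sup>2"
  shows "f \<in> koebe_means"
proof (rule koebe_means_pointwise_limit)
  define R where "R n = 1 - inverse (real (Suc n))" for n
  have R: "0 \<le> R n" "R n < 1" for n by (simp_all add: R_def field_simps)
  have Rz: "norm (of_real (R n) * z) < 1" if "norm z \<le> 1" for n and z :: complex
    using that R[of n] mult_left_le[of "norm z" "R n"] by (simp add: norm_mult)
  have hR: "(\<lambda>z. g (of_real (R n) * z)) holomorphic_on cball 0 1" for n
    by (rule holomorphic_on_compose_gen[OF _ hol, unfolded o_def])
       (use Rz in \<open>auto intro!: holomorphic_intros\<close>)
  show "disk_restrict (\<lambda>z. z * (g (of_real (R n) * z))\<^sup>2) \<in> koebe_means" for n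
    by (rule square_mem_koebe_means[OF hR]) (use g0 pos Rz in \<open>auto intro: less_imp_le\<close>)
  fix z :: complex assume z: "norm z < 1"
  have "R \<longlonglongrightarrow> 1"
    using tendsto_diff[OF tendsto_const LIMSEQ_inverse_real_of_nat, of 1] by (simp add: R_def[abs_def])
  then have "(\<lambda>n. of_real (R n) * z) \<longlonglongrightarrow> of_real 1 * z" by (intro tendsto_intros)
  moreover have "isCont g z"
    using holomorphic_on_imp_continuous_on[OF hol] z by (simp add: continuous_on_eq_continuous_at)
  ultimately have "(\<lambda>n. g (of_real (R n) * z)) \<longlonglongrightarrow> g z" using isCont_tendsto_compose by fastforce
  then have "(\<lambda>n. z * (g (of_real (R n) * z))\<^sup>2) \<longlonglongrightarrow> z * (g z)\<^sup>2" by (intro tendsto_intros)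
  moreover have "hol_fun (disk_restrict (\<lambda>z. z * (g (of_real (R n) * z))\<^sup>2)) z
      = z * (g (of_real (R n) * z))\<^sup>2" for n
    by (rule hol_fun_disk_restrict)
       (use z in \<open>auto intro!: holomorphic_intros holomorphic_on_subset[OF hR]\<close>)
  ultimately show "(\<lambda>n. hol_fun (disk_restrict (\<lambda>z. z * (g (of_real (R n) * z))\<^sup>2)) z) \<longlonglongrightarrow> hol_fun f z"
    using f[OF z] by simp
qed

text \<open>
  With \<open>q z = f z / z\<close> and \<open>p = 1 / q\<close> one has \<open>f' (z / f)\<^sup>2 = (q + z q') / q\<^sup>2 = p - z p'\<close>.  So the
  square root \<open>s\<close> of \<open>p\<close> stays within distance 1 of 1, and \<open>g = 1 / s\<close> has real part above \<open>1/2\<close>.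
\<close>

lemma class_U_subset_koebe_means: "class_U \<subseteq> koebe_means"
proof
  fix f assume "f \<in> class_U"
  define F where "F = hol_fun f"
  have F: "F 0 = 0 \<and> deriv F 0 = 1" "\<forall>z\<in>unit_disk - {0}. F z \<noteq> 0"
    "\<forall>z\<in>unit_disk. norm (deriv F z * (if z = 0 then 1 else z / F z)\<^sup>2 - 1) < 1"
    using \<open>f \<in> class_U\<close> unfolding F_def class_U_def normalized_class_def by blast+
  have F0: "F 0 = 0" "deriv F 0 = 1" using F(1) by simp_all
  have Fnz: "F z \<noteq> 0" if "norm z < 1" "z \<noteq> 0" for z using F(2) that by simp
  have small: "norm (deriv F z * (if z = 0 then 1 else z / F z)\<^sup>2 - 1) < 1" if "norm z < 1" for z
    using bspec[OF F(3), of z] that by simp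
  have hF: "F holomorphic_on unit_disk" unfolding F_def by (rule holomorphic_hol_fun)
  define q where "q z = (if z = 0 then deriv F 0 else (F z - F 0) / (z - 0))" for z
  have hq: "q holomorphic_on unit_disk"
    unfolding q_def[abs_def] by (rule pole_lemma[OF hF]) simp
  have Fq: "F z = z * q z" for z by (simp add: q_def F0)
  have q0: "q 0 = 1" by (simp add: q_def F0)
  have qnz: "q z \<noteq> 0" if "norm z < 1" for z using Fnz[OF that] by (auto simp: q_def F0)
  have dq: "(q has_field_derivative deriv q z) (at z)" if "norm z < 1" for z
    using holomorphic_derivI[OF hq open_ball] that by simp
  obtain s where s: "s holomorphic_on unit_disk" "s 0 = 1"
    "\<And>z. norm z < 1 \<Longrightarrow> 1 / q z = (s z)\<^sup>2" "\<And>z. norm z < 1 \<Longrightarrow> norm (s z - 1) < 1"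
  proof (rule root_in_right_half_plane[where p = "\<lambda>z. 1 / q z"])
    show "(\<lambda>z. 1 / q z) holomorphic_on unit_disk" by (intro holomorphic_intros hq) (use qnz in auto)
    show "norm (1 / q z - z * deriv (\<lambda>z. 1 / q z) z - 1) < 1" if z: "norm z < 1" for z
    proof -
      have "((\<lambda>z. 1 / q z) has_field_derivative - deriv q z / (q z)\<^sup>2) (at z)"
        using dq[OF z] qnz[OF z] by (auto intro!: derivative_eq_intros simp: power2_eq_square)
      then have dp: "deriv (\<lambda>z. 1 / q z) z = - deriv q z / (q z)\<^sup>2" by (rule DERIV_imp_deriv)
      have "F = (\<lambda>z. z * q z)" using Fq by auto
      then have dF: "deriv F z = q z + z * deriv q z"
        using dq[OF z] by (auto intro!: DERIV_imp_deriv derivative_eq_intros)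
      have "(if z = 0 then 1 else z / F z) = 1 / q z"
        using Fq[of z] q0 by (auto simp: q0)
      then have "deriv F z * (if z = 0 then 1 else z / F z)\<^sup>2 - 1 = (q z + z * deriv q z) * (1 / q z)\<^sup>2 - 1"
        by (simp only: dF)
      also have "\<dots> = 1 / q z - z * deriv (\<lambda>z. 1 / q z) z - 1"
        using qnz[OF z] by (simp add: dp field_simps power2_eq_square)
      finally show ?thesis using small[OF z] by simp
    qed
  qed (use q0 qnz in auto)
  have snz: "s z \<noteq> 0" if "norm z < 1" for z using Re_inverse_gt_half(1)[OF s(4)[OF that]] .
  show "f \<in> koebe_means"
  proof (rule square_mem_koebe_means_open_disk[where g = "\<lambda>z. 1 / s z"])
    show "(\<lambda>z. 1 / s z) holomorphic_on unit_disk" by (intro holomorphic_intros s(1)) (use snz in auto)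
    show "Re (1 / s z) > 1 / 2" if "norm z < 1" for z using Re_inverse_gt_half(2)[OF s(4)[OF that]] .
    show "hol_fun f z = z * (1 / s z)\<^sup>2" if "norm z < 1" for z
      using s(3)[OF that] snz[OF that] qnz[OF that] Fq[of z]
      by (simp add: F_def power_divide field_simps)
  qed (simp add: s(2))
qed

text \<open>
  Since \<open>k' z = (1 + x z) / (1 - x z)\<^sup>3\<close>, the defining expression is
  \<open>(1 + x z) (1 - x z) - 1 = - (x z)\<^sup>2\<close>.
\<close>

lemma koebe_mem_class_U:
  assumes x: "norm x = 1"
  shows "koebe x \<in> class_U"
proof -
  have nz: "1 - x * z \<noteq> 0" if "norm z < 1" for z
    using one_minus_mult_nonzero[OF that, of x] x by simp
  have d: "deriv (hol_fun (koebe x)) z = (1 + x * z) / (1 - x * z) ^ 3" if z: "norm z < 1" for z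
  proof -
    have "deriv (hol_fun (koebe x)) z = deriv (\<lambda>z. z / (1 - x * z)\<^sup>2) z"
    proof (rule deriv_cong_ev)
      show "eventually (\<lambda>z. hol_fun (koebe x) z = z / (1 - x * z)\<^sup>2) (nhds z)"
        using eventually_nhds_in_open[of unit_disk z] z x
        by (auto elim!: eventually_mono simp: hol_fun_koebe)
    qed simp
    also have "\<dots> = (1 + x * z) / (1 - x * z) ^ 3"
      by (rule DERIV_imp_deriv)
         (use nz[OF z] in \<open>auto intro!: derivative_eq_intros simp: divide_simps power2_eq_square power3_eq_cube; simp add: algebra_simps\<close>)
    finally show ?thesis .
  qed
  have "norm (deriv (hol_fun (koebe x)) z * (if z = 0 then 1 else z / hol_fun (koebe x) z)\<^sup>2 - 1) < 1"
    if z: "norm z < 1" for z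
  proof -
    have "(if z = 0 then 1 else z / hol_fun (koebe x) z) = (1 - x * z)\<^sup>2"
      using nz[OF z] z x by (simp add: hol_fun_koebe)
    then have "deriv (hol_fun (koebe x)) z * (if z = 0 then 1 else z / hol_fun (koebe x) z)\<^sup>2 - 1
        = (1 + x * z) / (1 - x * z) ^ 3 * ((1 - x * z)\<^sup>2)\<^sup>2 - 1"
      by (simp only: d[OF z])
    also have "\<dots> = (1 + x * z) * (1 - x * z) - 1"
    proof -
      have "((1 - x * z)\<^sup>2)\<^sup>2 = (1 - x * z) ^ 3 * (1 - x * z)"
        by (simp only: power2_eq_square power3_eq_cube mult.assoc)
      then show ?thesis using nz[OF z] by simp
    qed
    also have "\<dots> = - (x * z)\<^sup>2" by (simp add: power2_eq_square algebra_simps)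
    finally show ?thesis using z x by (simp add: norm_power norm_mult power_less_one_iff)
  qed
  then show ?thesis
    using nz x d[of 0] by (auto simp: class_U_def normalized_class_def hol_fun_koebe)
qed

lemma closed_convex_hull_class_U: "closed_convex_hull class_U = koebe_means"
proof
  show "closed_convex_hull class_U \<subseteq> koebe_means"
    unfolding closed_convex_hull_def
    by (rule hull_minimal[OF class_U_subset_koebe_means]) (simp add: closed_koebe_means convex_koebe_means)
  show "koebe_means \<subseteq> closed_convex_hull class_U"
    unfolding closed_convex_hull_def hull_def
    by (intro Inter_greatest) (use koebe_means_subset_closed_convex koebe_mem_class_U in blast)
qed

section \<open>Extreme points\<close>

text \<open>
  Among the points of the circle, \<open>x0\<close> alone attains the least possible distance
  of \<open>x * cnj x0 / 2\<close> from 1.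
\<close>

lemma circle_eqI:
  assumes "norm x = 1" "norm x0 = 1" and "norm (1 - x * (cnj x0 / 2)) = 1/2"
  shows "x = x0"
proof -
  define y where "y = x * cnj x0"
  have y: "(Re y)\<^sup>2 + (Im y)\<^sup>2 = 1" using assms(1,2) cmod_power2[of y] by (simp add: y_def norm_mult)
  have "norm (2 - y) = 1"
  proof -
    have "2 - y = 2 * (1 - x * (cnj x0 / 2))" by (simp add: y_def algebra_simps)
    then have "norm (2 - y) = 2 * norm (1 - x * (cnj x0 / 2))" by (simp only: norm_mult norm_numeral)
    then show ?thesis using assms(3) by simp
  qed
  then have "(2 - Re y)\<^sup>2 + (Im y)\<^sup>2 = 1" using cmod_power2[of "2 - y"] by simp
  with y have "Re y = 1" by (simp add: power2_eq_square algebra_simps)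
  with y have "y = 1" by (simp add: complex_eq_iff)
  have "x0 * cnj x0 = 1" using complex_norm_square[of x0] assms(2) by simp
  then have "x = y * x0" by (simp add: y_def mult.assoc mult.commute[of "cnj x0"])
  with \<open>y = 1\<close> show ?thesis by simp
qed

text \<open>
  At \<open>z\<^sub>0 = cnj x0 / 2\<close> one has \<open>1 / z\<^sub>0 = 2 * x0\<close>, so the functional is \<open>Re (f z\<^sub>0 / z\<^sub>0)\<close>, the average of
  \<open>Re (1 / (1 - x z\<^sub>0)\<^sup>2)\<close>.  The integrand is at most 4, with equality only at \<open>x = x0\<close>; so equality
  for the average forces the representing measure to be the point mass at \<open>x0\<close>.
\<close>

lemma koebe_means_peak:
  assumes x0: "norm x0 = 1" and f: "f \<in> koebe_means"
  shows "Re (2 * x0 * hol_fun f (cnj x0 / 2)) \<le> 4"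
    and "Re (2 * x0 * hol_fun f (cnj x0 / 2)) = 4 \<Longrightarrow> f = koebe x0"
proof -
  obtain \<mu> where \<mu>: "\<mu> \<in> circle_prob_measures"
    and rep: "\<forall>z\<in>unit_disk. hol_fun f z = (\<integral>x. z / (1 - x * z)\<^sup>2 \<partial>\<mu>)"
    by (rule koebe_meansE[OF f])
  interpret prob_space \<mu> using \<mu> by (simp add: circle_prob_measures_def)
  define z0 where "z0 = cnj x0 / 2"
  have z0: "norm z0 = 1/2" "norm z0 < 1" using x0 by (simp_all add: z0_def)
  have x0z0: "2 * x0 * z0 = 1" using complex_norm_square[of x0] x0 by (simp add: z0_def)
  define h where "h x = 1 / (1 - x * z0)\<^sup>2" for x
  have h: "2 * x0 * (z0 / (1 - x * z0)\<^sup>2) = h x" for x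
    using x0z0 by (simp add: h_def flip: mult.assoc)
  have nz: "1 - x * z0 \<noteq> 0" if "norm x = 1" for x using one_minus_mult_nonzero[OF z0(2)] that by simp
  have ch: "continuous_on circle h" unfolding h_def by (intro continuous_intros) (use nz in auto)
  have inth: "integrable \<mu> h" by (rule integrable_circle_measure[OF \<mu> ch])
  have L: "Re (2 * x0 * hol_fun f (cnj x0 / 2)) = (\<integral>x. Re (h x) \<partial>\<mu>)"
  proof -
    have "hol_fun f z0 = (\<integral>x. z0 / (1 - x * z0)\<^sup>2 \<partial>\<mu>)" using bspec[OF rep, of z0] z0 by simp
    then have "2 * x0 * hol_fun f z0 = (\<integral>x. 2 * x0 * (z0 / (1 - x * z0)\<^sup>2) \<partial>\<mu>)"
      by (simp only: integral_mult_right_zero)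
    also have "\<dots> = (\<integral>x. h x \<partial>\<mu>)" by (simp only: h)
    finally show ?thesis using inth by (simp add: z0_def)
  qed
  have lower: "norm (1 - x * z0) \<ge> 1/2" if "norm x = 1" for x
    using norm_triangle_ineq2[of 1 "x * z0"] that z0 by (simp add: norm_mult)
  have norm_h: "norm (h x) = 1 / (norm (1 - x * z0))\<^sup>2" for x by (simp add: h_def norm_divide norm_power)
  have norm_le: "norm (h x) \<le> 4" if "norm x = 1" for x
  proof -
    have "(1/2)\<^sup>2 \<le> (norm (1 - x * z0))\<^sup>2" by (rule power_mono[OF lower[OF that]]) simp
    then have "1 / (norm (1 - x * z0))\<^sup>2 \<le> 1 / (1/2)\<^sup>2" by (rule divide_left_mono) (use nz[OF that] in auto)
    then show ?thesis by (simp add: norm_h power2_eq_square)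
  qed
  have Re_le: "Re (h x) \<le> 4" if "norm x = 1" for x
    using norm_le[OF that] complex_Re_le_cmod[of "h x"] by linarith
  have intRe: "integrable \<mu> (\<lambda>x. Re (h x))" using inth by (rule integrable_Re)
  show "Re (2 * x0 * hol_fun f (cnj x0 / 2)) \<le> 4"
    unfolding L
    by (rule integral_le_const[OF intRe], rule AE_I2) (simp add: Re_le space_circle_measure[OF \<mu>])
  assume "Re (2 * x0 * hol_fun f (cnj x0 / 2)) = 4"
  then have "(\<integral>x. 4 - Re (h x) \<partial>\<mu>) = 0" unfolding L using intRe by (simp add: prob_space)
  moreover have "integrable \<mu> (\<lambda>x. 4 - Re (h x))" using intRe by simp
  moreover have "AE x in \<mu>. 0 \<le> 4 - Re (h x)"
    by (rule AE_I2) (simp add: Re_le space_circle_measure[OF \<mu>])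
  ultimately have "AE x in \<mu>. 4 - Re (h x) = 0" using integral_nonneg_eq_0_iff_AE by blast
  then have AE: "AE x in \<mu>. x = x0"
  proof (rule AE_mp, intro AE_I2 impI)
    fix x assume "x \<in> space \<mu>" and eq: "4 - Re (h x) = 0"
    then have x: "norm x = 1" by (simp add: space_circle_measure[OF \<mu>])
    have "norm (h x) = 4" using eq norm_le[OF x] complex_Re_le_cmod[of "h x"] by linarith
    then have "(norm (1 - x * z0))\<^sup>2 = (1/2)\<^sup>2"
      using nz[OF x] by (simp add: norm_h field_simps power2_eq_square)
    then have "norm (1 - x * z0) = 1/2" by (rule power2_eq_imp_eq) auto
    then show "x = x0" using circle_eqI[OF x x0] by (simp add: z0_def)
  qed
  show "f = koebe x0"
  proof (rule hol_disk_eqI)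
    fix z assume z: "z \<in> unit_disk"
    have m: "(\<lambda>x. z / (1 - x * z)\<^sup>2) \<in> borel_measurable \<mu>"
      by (intro borel_measurable_circle_measure[OF \<mu>] continuous_on_koebe_kernel) (use z in auto)
    have "(\<integral>x. z / (1 - x * z)\<^sup>2 \<partial>\<mu>) = (\<integral>x. z / (1 - x0 * z)\<^sup>2 \<partial>\<mu>)"
      by (rule integral_cong_AE[OF m _ AE_mp[OF AE]]) (auto intro!: AE_I2)
    then show "hol_fun f z = hol_fun (koebe x0) z"
      using bspec[OF rep z] z x0 by (simp add: hol_fun_koebe prob_space)
  qed
qed

lemma koebe_extreme_point:
  assumes x0: "norm x0 = 1"
  shows "koebe x0 extreme_point_of koebe_means"
  unfolding extreme_point_of_def
proof (intro conjI ballI notI)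
  show "koebe x0 \<in> koebe_means" by (rule koebe_mem_koebe_means) (simp add: x0)
  fix a b assume a: "a \<in> koebe_means" and b: "b \<in> koebe_means" and "koebe x0 \<in> open_segment a b"
  then obtain u where "a \<noteq> b" and u: "0 < u" "u < 1" and eq: "koebe x0 = (1 - u) *\<^sub>R a + u *\<^sub>R b"
    unfolding in_segment by (elim conjE exE)
  define L where "L f = Re (2 * x0 * hol_fun f (cnj x0 / 2))" for f
  have z0: "cnj x0 / 2 \<in> unit_disk" using x0 by simp
  have x0x0: "x0 * cnj x0 = 1" using complex_norm_square[of x0] x0 by simp
  have "L (koebe x0) = 4"
  proof -
    have "2 * x0 * hol_fun (koebe x0) (cnj x0 / 2) = x0 * cnj x0 / (1 - x0 * cnj x0 / 2)\<^sup>2"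
      using z0 x0 by (simp add: hol_fun_koebe)
    also have "\<dots> = 4" by (simp add: x0x0 power2_eq_square)
    finally show ?thesis unfolding L_def by (simp only: complex_Re_numeral)
  qed
  moreover have "L (koebe x0) = (1 - u) * L a + u * L b"
    unfolding eq L_def hol_fun_add[OF z0] hol_fun_scaleR[OF z0] by (simp add: algebra_simps)
  ultimately have sum: "(1 - u) * (4 - L a) + u * (4 - L b) = 0" by (simp add: algebra_simps)
  have le: "L a \<le> 4" "L b \<le> 4" using koebe_means_peak(1)[OF x0] a b by (simp_all add: L_def)
  have "(1 - u) * (4 - L a) = 0 \<and> u * (4 - L b) = 0"
    using sum le u by (subst add_nonneg_eq_0_iff[symmetric]) auto
  then have "L a = 4" "L b = 4" using u by auto
  then have "a = koebe x0" "b = koebe x0"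
    using koebe_means_peak(2)[OF x0 a, folded L_def] koebe_means_peak(2)[OF x0 b, folded L_def] by simp_all
  with \<open>a \<noteq> b\<close> show False by simp
qed

lemma uniform_circle_measure:
  assumes \<mu>: "\<mu> \<in> circle_prob_measures" and A: "A \<in> sets \<mu>" and pos: "measure \<mu> A > 0"
  shows "uniform_measure \<mu> A \<in> circle_prob_measures"
    and "continuous_on circle h \<Longrightarrow>
      of_real (measure \<mu> A) * (\<integral>x. h x \<partial>uniform_measure \<mu> A) = (\<integral>x. indicator A x *\<^sub>R (h x :: complex) \<partial>\<mu>)"
proof -
  interpret prob_space \<mu> using \<mu> by (simp add: circle_prob_measures_def)
  have "prob_space (uniform_measure \<mu> A)"
    by (rule prob_space_uniform_measure) (use pos in \<open>auto simp: emeasure_eq_measure\<close>)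
  then show "uniform_measure \<mu> A \<in> circle_prob_measures"
    using \<mu> by (simp add: circle_prob_measures_def)
  assume h: "continuous_on circle h"
  have "uniform_measure \<mu> A = density \<mu> (\<lambda>x. ennreal (indicator A x / measure \<mu> A))"
    unfolding uniform_measure_def emeasure_eq_measure
    by (intro arg_cong[where f = "density \<mu>"] ext)
       (use pos in \<open>auto simp: indicator_def divide_ennreal simp flip: ennreal_1\<close>)
  moreover have "(\<integral>x. h x \<partial>density \<mu> (\<lambda>x. ennreal (indicator A x / measure \<mu> A)))
      = (\<integral>x. (indicator A x / measure \<mu> A) *\<^sub>R h x \<partial>\<mu>)"
    by (rule integral_density[OF borel_measurable_circle_measure[OF \<mu> h]]) (use A in auto)
  moreover have "(indicator A x / measure \<mu> A) *\<^sub>R h x = (1 / of_real (measure \<mu> A)) * (indicator A x *\<^sub>R h x)" for x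
    by (simp add: scaleR_conv_of_real)
  ultimately have "(\<integral>x. h x \<partial>uniform_measure \<mu> A)
      = (1 / of_real (measure \<mu> A)) * (\<integral>x. indicator A x *\<^sub>R h x \<partial>\<mu>)"
    by (simp only: integral_mult_right_zero)
  then show "of_real (measure \<mu> A) * (\<integral>x. h x \<partial>uniform_measure \<mu> A) = (\<integral>x. indicator A x *\<^sub>R h x \<partial>\<mu>)"
    using pos by simp
qed

text \<open>
  Conditioning \<open>\<mu>\<close> on \<open>A\<close> and on its complement writes \<open>f\<close> as a proper convex combination of two
  means, unless the complement is a null set.  By extremality both means equal \<open>f\<close>.
\<close>

lemma extreme_point_eq_conditional_mean:
  assumes ext: "f extreme_point_of koebe_means" and \<mu>: "\<mu> \<in> circle_prob_measures"
    and rep: "\<forall>z\<in>unit_disk. hol_fun f z = (\<integral>x. z / (1 - x * z)\<^sup>2 \<partial>\<mu>)"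
    and A: "A \<in> sets \<mu>" and pos: "measure \<mu> A > 0" and z: "norm z < 1"
  shows "hol_fun f z = (\<integral>x. z / (1 - x * z)\<^sup>2 \<partial>uniform_measure \<mu> A)"
proof -
  interpret prob_space \<mu> using \<mu> by (simp add: circle_prob_measures_def)
  define B where "B = space \<mu> - A"
  define F where "F C = disk_restrict (\<lambda>z. \<integral>x. z / (1 - x * z)\<^sup>2 \<partial>uniform_measure \<mu> C)" for C
  have B: "B \<in> sets \<mu>" using A by (auto simp: B_def)
  have pB: "prob B = 1 - prob A" unfolding B_def by (rule prob_compl[OF A])
  note ck = continuous_on_koebe_kernel[where T = circle]
  have F: "hol_fun (F C) z = (\<integral>x. z / (1 - x * z)\<^sup>2 \<partial>uniform_measure \<mu> C)"
    if "C \<in> sets \<mu>" "prob C > 0" "z \<in> unit_disk" for C z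
    unfolding F_def
    by (rule hol_fun_disk_restrict[OF holomorphic_koebe_mean[OF uniform_circle_measure(1)[OF \<mu> that(1,2)]] that(3)])
  have Fmem: "F C \<in> koebe_means" if "C \<in> sets \<mu>" "prob C > 0" for C
    by (rule koebe_means_measureI[OF uniform_circle_measure(1)[OF \<mu> that] F[OF that]])
  have split: "hol_fun f z = (\<integral>x. indicator A x *\<^sub>R (z / (1 - x * z)\<^sup>2) \<partial>\<mu>)
      + (\<integral>x. indicator B x *\<^sub>R (z / (1 - x * z)\<^sup>2) \<partial>\<mu>)" if z: "z \<in> unit_disk" for z
  proof -
    have i: "integrable \<mu> (\<lambda>x. z / (1 - x * z)\<^sup>2)"
      by (rule integrable_circle_measure[OF \<mu> ck]) (use z in auto)
    have "(\<integral>x. z / (1 - x * z)\<^sup>2 \<partial>\<mu>)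
        = (\<integral>x. indicator A x *\<^sub>R (z / (1 - x * z)\<^sup>2) + indicator B x *\<^sub>R (z / (1 - x * z)\<^sup>2) \<partial>\<mu>)"
      by (rule Bochner_Integration.integral_cong) (auto simp: B_def indicator_def)
    also have "\<dots> = (\<integral>x. indicator A x *\<^sub>R (z / (1 - x * z)\<^sup>2) \<partial>\<mu>)
        + (\<integral>x. indicator B x *\<^sub>R (z / (1 - x * z)\<^sup>2) \<partial>\<mu>)"
      by (rule Bochner_Integration.integral_add; rule integrable_mult_indicator[OF _ i]; fact)
    finally show ?thesis using bspec[OF rep z] by simp
  qed
  show ?thesis
  proof (cases "prob A = 1")
    case True
    then have "AE x in \<mu>. x \<in> A" using A by (simp add: AE_in_set_eq_1)
    then have "(\<integral>x. indicator B x *\<^sub>R (z / (1 - x * z)\<^sup>2) \<partial>\<mu>) = 0"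
      by (intro integral_eq_zero_AE) (auto simp: B_def indicator_def)
    with split[of z] uniform_circle_measure(2)[OF \<mu> A pos ck[of z]] z True show ?thesis by simp
  next
    case False
    then have lt: "prob A < 1" by (simp add: less_le)
    then have posB: "prob B > 0" by (simp add: pB)
    have "f = prob A *\<^sub>R F A + (1 - prob A) *\<^sub>R F B"
    proof (rule hol_disk_eqI)
      fix z assume z: "z \<in> unit_disk"
      then have z1: "norm z < 1" by simp
      have "hol_fun (prob A *\<^sub>R F A + (1 - prob A) *\<^sub>R F B) z
          = of_real (prob A) * hol_fun (F A) z + of_real (prob B) * hol_fun (F B) z"
        by (simp only: hol_fun_add[OF z] hol_fun_scaleR[OF z] pB)
      also have "\<dots> = hol_fun f z"
        unfolding F[OF A pos z] F[OF B posB z] split[OF z]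
          uniform_circle_measure(2)[OF \<mu> A pos ck[OF z1 sphere_cball]]
          uniform_circle_measure(2)[OF \<mu> B posB ck[OF z1 sphere_cball]] ..
      finally show "hol_fun f z = hol_fun (prob A *\<^sub>R F A + (1 - prob A) *\<^sub>R F B) z" ..
    qed
    then have f: "f = (1 - prob A) *\<^sub>R F B + prob A *\<^sub>R F A" by (simp add: add.commute)
    have "F B = F A"
    proof (rule ccontr)
      assume "F B \<noteq> F A"
      then have "f \<in> open_segment (F B) (F A)"
        unfolding in_segment using f pos lt by blast
      then show False
        using ext Fmem[OF A pos] Fmem[OF B posB] unfolding extreme_point_of_def by blast
    qed
    then have "f = F A" using f by (simp flip: scaleR_left_distrib)
    then show ?thesis using F[OF A pos, of z] z by simp
  qed
qed

lemma circle_measure_support_point: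
  assumes \<mu>: "\<mu> \<in> circle_prob_measures"
  obtains x0 where "norm x0 = 1" "\<forall>d>0. measure \<mu> (ball x0 d \<inter> circle) > 0"
proof (rule ccontr)
  interpret prob_space \<mu> using \<mu> by (simp add: circle_prob_measures_def)
  assume "\<not> thesis"
  have "\<forall>x\<in>circle. \<exists>d>0. prob (ball x d \<inter> circle) = 0"
  proof (rule ballI, rule ccontr)
    fix x assume x: "x \<in> circle" and "\<not> (\<exists>d>0. prob (ball x d \<inter> circle) = 0)"
    then have "\<forall>d>0. prob (ball x d \<inter> circle) > 0" by (simp add: zero_less_measure_iff)
    with that[of x] x \<open>\<not> thesis\<close> show False by simp
  qed
  then obtain d where d: "\<And>x. x \<in> circle \<Longrightarrow> d x > 0" "\<And>x. x \<in> circle \<Longrightarrow> prob (ball x (d x) \<inter> circle) = 0"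
    by metis
  have meas: "ball x r \<inter> circle \<in> sets \<mu>" for x r
    using \<mu> by (auto simp: circle_prob_measures_def sets_restrict_space)
  have "compact circle" by simp
  moreover have "circle \<subseteq> (\<Union>x\<in>circle. ball x (d x))" using d(1) by (intro subsetI UN_I) auto
  ultimately obtain D where D: "D \<subseteq> circle" "finite D" "circle \<subseteq> (\<Union>x\<in>D. ball x (d x))"
    using compactE_image[of circle circle "\<lambda>x. ball x (d x)"] by (metis open_ball)
  have "space \<mu> = (\<Union>x\<in>D. ball x (d x) \<inter> circle)"
    using D(3) unfolding space_circle_measure[OF \<mu>] by blast
  then have "prob (space \<mu>) \<le> (\<Sum>x\<in>D. prob (ball x (d x) \<inter> circle))"
    using finite_measure_subadditive_finite[OF D(2), of "\<lambda>x. ball x (d x) \<inter> circle"] meas by auto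
  also have "\<dots> = 0" using d(2) D(1) by (intro sum.neutral) auto
  finally show False by (simp add: prob_space)
qed

text \<open>
  Conditioning on ever smaller neighbourhoods of a support point \<open>x0\<close> does not change \<open>f\<close>, while the
  conditional means converge to the Koebe function of \<open>x0\<close> by continuity of the kernel.
\<close>

lemma extreme_point_koebe_means_is_koebe:
  assumes ext: "f extreme_point_of koebe_means"
  obtains x0 where "norm x0 = 1" "f = koebe x0"
proof -
  have "f \<in> koebe_means" using ext by (simp add: extreme_point_of_def)
  then obtain \<mu> where \<mu>: "\<mu> \<in> circle_prob_measures"
    and rep: "\<forall>z\<in>unit_disk. hol_fun f z = (\<integral>x. z / (1 - x * z)\<^sup>2 \<partial>\<mu>)"
    by (rule koebe_meansE)
  obtain x0 where x0: "norm x0 = 1" and supp: "\<forall>d>0. measure \<mu> (ball x0 d \<inter> circle) > 0"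
    by (rule circle_measure_support_point[OF \<mu>])
  have "hol_fun f z = hol_fun (koebe x0) z" if z: "z \<in> unit_disk" for z
  proof -
    have z1: "norm z < 1" using z by simp
    define h where "h = (\<lambda>x. z / (1 - x * z)\<^sup>2)"
    have ch: "continuous_on circle h" unfolding h_def by (rule continuous_on_koebe_kernel[OF z1 sphere_cball])
    have "norm (hol_fun f z - h x0) \<le> e" if e: "e > 0" for e
    proof -
      obtain d where d: "d > 0" "\<And>x. x \<in> circle \<Longrightarrow> dist x x0 < d \<Longrightarrow> dist (h x) (h x0) < e"
        using ch e x0 unfolding continuous_on_iff by (metis mem_sphere_0)
      define A where "A = ball x0 d \<inter> circle"
      have A: "A \<in> sets \<mu>"
        using \<mu> by (auto simp: A_def circle_prob_measures_def sets_restrict_space)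
      have pos: "measure \<mu> A > 0" using supp d(1) by (simp add: A_def)
      note \<nu> = uniform_circle_measure(1)[OF \<mu> A pos]
      interpret \<nu>: prob_space "uniform_measure \<mu> A" using \<nu> by (simp add: circle_prob_measures_def)
      have int: "integrable (uniform_measure \<mu> A) (\<lambda>x. h x - h x0)"
        by (intro integrable_circle_measure[OF \<nu>] continuous_intros ch)
      have "hol_fun f z - h x0 = (\<integral>x. h x \<partial>uniform_measure \<mu> A) - h x0"
        using extreme_point_eq_conditional_mean[OF ext \<mu> rep A pos z1] by (simp add: h_def)
      also have "\<dots> = (\<integral>x. h x - h x0 \<partial>uniform_measure \<mu> A)"
        using integrable_circle_measure[OF \<nu> ch] \<nu>.prob_space by simp
      finally have "norm (hol_fun f z - h x0) \<le> (\<integral>x. norm (h x - h x0) \<partial>uniform_measure \<mu> A)"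
        by simp
      also have "\<dots> \<le> e"
      proof (rule \<nu>.integral_le_const)
        show "integrable (uniform_measure \<mu> A) (\<lambda>x. norm (h x - h x0))" using int by simp
        show "AE x in uniform_measure \<mu> A. norm (h x - h x0) \<le> e"
          by (rule AE_uniform_measureI[OF A])
             (use d(2) in \<open>auto simp: A_def dist_commute dist_norm intro!: AE_I2 less_imp_le\<close>)
      qed
      finally show ?thesis .
    qed
    then have "norm (hol_fun f z - h x0) \<le> 0" by (rule field_le_epsilon[of _ 0, simplified])
    then show ?thesis using hol_fun_koebe[of x0 z] x0 z1 by (simp add: h_def)
  qed
  then have "f = koebe x0" by (rule hol_disk_eqI)
  with x0 that show ?thesis by blast
qed

theorem theorem3p1:
  shows "hol_fun ` closed_convex_hull class_U =
      {\<lambda>z\<in>unit_disk. \<integral>x. z / (1 - x * z)\<^sup>2 \<partial>\<mu> | \<mu>. \<mu> \<in> circle_prob_measures}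
    \<and> hol_fun ` {f. f extreme_point_of closed_convex_hull class_U} =
      {\<lambda>z\<in>unit_disk. z / (1 - x * z)\<^sup>2 | x. cmod x = 1}"
proof
  show "hol_fun ` closed_convex_hull class_U =
      {\<lambda>z\<in>unit_disk. \<integral>x. z / (1 - x * z)\<^sup>2 \<partial>\<mu> | \<mu>. \<mu> \<in> circle_prob_measures}"
    unfolding closed_convex_hull_class_U by (rule hol_fun_image_koebe_means)
  have restrict: "hol_fun (koebe x) = (\<lambda>z\<in>unit_disk. z / (1 - x * z)\<^sup>2)" if "cmod x = 1" for x
    by (rule hol_fun_eq_restrictI) (simp add: hol_fun_koebe that)
  have "{f. f extreme_point_of koebe_means} = koebe ` {x. cmod x = 1}"
  proof (intro equalityI subsetI)
    fix f assume "f \<in> {f. f extreme_point_of koebe_means}"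
    then show "f \<in> koebe ` {x. cmod x = 1}"
      by (auto elim!: extreme_point_koebe_means_is_koebe)
  qed (auto intro: koebe_extreme_point)
  then have "hol_fun ` {f. f extreme_point_of koebe_means} = (\<lambda>x. hol_fun (koebe x)) ` {x. cmod x = 1}"
    by (simp only: image_image)
  also have "\<dots> = (\<lambda>x. \<lambda>z\<in>unit_disk. z / (1 - x * z)\<^sup>2) ` {x. cmod x = 1}"
    by (rule image_cong[OF refl]) (simp only: restrict mem_Collect_eq)
  also have "\<dots> = {\<lambda>z\<in>unit_disk. z / (1 - x * z)\<^sup>2 | x. cmod x = 1}"
    by (rule image_Collect)
  finally show "hol_fun ` {f. f extreme_point_of closed_convex_hull class_U} =
      {\<lambda>z\<in>unit_disk. z / (1 - x * z)\<^sup>2 | x. cmod x = 1}"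
    unfolding closed_convex_hull_class_U .
qed

end
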